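(* Let $\Sigma\subset\mathbb{R}^3$ be a smooth compact surface diffeomorphic to $S^1\times[0,1]$ and let $j$ be a smooth tangent field on $\Sigma$ with $\operatorname{div}_\Sigma(j)=0$ and $j$ tangent to $\partial\Sigma$. Then there is a subset $S\subset\Sigma$ of zero area such that every orbit of $j$ starting at a point of $\Sigma\setminus S$ is periodic. Moreover, if the orbit $\gamma_p$ of $j$ starting at $p\in\Sigma$ is non-periodic, then $\omega(p)\subset\{q\in\Sigma\mid j(q)=0\}$. In particular, if $j(p)\neq0$ for all $p\in\Sigma$, then all orbits of $j$ are proper periodic orbits and all of them represent non-trivial elements of the fundamental group of $\Sigma$.
   Context: Fixed points (zeros of $j$) count as periodic orbits; a proper periodic orbit is a non-constant periodic orbit. $\omega(p)$ is the set of points $q$ such that $\gamma_p(t_k)\to q$ for some sequence $t_k\to+\infty$. Area refers to the surface measure induced from $\mathbb{R}^3$. *)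

theory Defs
  imports "HOL-Analysis.Analysis"
begin

text \<open>C-infinity maps between Euclidean spaces: there is a family D of iterated
  directional derivatives, D [] = f, and each D vs is (Frechet) differentiable
  everywhere with derivative h \<mapsto> D (h # vs).\<close>
definition smooth :: "('a::euclidean_space \<Rightarrow> 'b::real_normed_vector) \<Rightarrow> bool" where
  "smooth f \<longleftrightarrow> (\<exists>D :: 'a list \<Rightarrow> 'a \<Rightarrow> 'b. D [] = f \<and>
      (\<forall>vs x. (D vs has_derivative (\<lambda>h. D (h # vs) x)) (at x)))"

type_synonym R3 = "real ^ 3"

definition Fs :: "(real \<times> real \<Rightarrow> R3) \<Rightarrow> real \<times> real \<Rightarrow> R3" where
  "Fs F x = frechet_derivative F (at x) (1, 0)"
definition Ft :: "(real \<times> real \<Rightarrow> R3) \<Rightarrow> real \<times> real \<Rightarrow> R3" where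
  "Ft F x = frechet_derivative F (at x) (0, 1)"

definition strip :: "(real \<times> real) set" where
  "strip = UNIV \<times> {0..1}"

text \<open>F is a smooth embedding of S^1 \<times> [0,1] (S^1 = R/Z) into R^3, given as a
  smooth map on R^2 (smooth up to the boundary), 1-periodic in the first variable,
  injective on the fundamental domain [0,1) \<times> [0,1], and an immersion there.
  Its image is the annulus Sigma.\<close>
definition annulus_param :: "(real \<times> real \<Rightarrow> R3) \<Rightarrow> bool" where
  "annulus_param F \<longleftrightarrow> smooth F \<and> (\<forall>s t. F (s + 1, t) = F (s, t)) \<and>
     inj_on F ({0..<1} \<times> {0..1}) \<and>
     (\<forall>x\<in>strip. \<not> (\<exists>a b. (a, b) \<noteq> (0, 0) \<and> a *\<^sub>R Fs F x + b *\<^sub>R Ft F x = 0))"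

definition surf :: "(real \<times> real \<Rightarrow> R3) \<Rightarrow> R3 set" where
  "surf F = F ` strip"

text \<open>Tangential (surface) divergence of a field j at F(x):
  div_Sigma j = g^{ik} <F_i, Dj F_k>, with g the first fundamental form.\<close>
definition surf_div :: "(real \<times> real \<Rightarrow> R3) \<Rightarrow> (R3 \<Rightarrow> R3) \<Rightarrow> real \<times> real \<Rightarrow> real" where
  "surf_div F j x =
    (let a = Fs F x; b = Ft F x; Dj = frechet_derivative j (at (F x));
         E = a \<bullet> a; M = a \<bullet> b; G = b \<bullet> b
     in (G * (a \<bullet> Dj a) - M * (a \<bullet> Dj b + b \<bullet> Dj a) + E * (b \<bullet> Dj b)) / (E * G - M\<^sup>2))"

definition tangent_field :: "(real \<times> real \<Rightarrow> R3) \<Rightarrow> (R3 \<Rightarrow> R3) \<Rightarrow> bool" where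
  "tangent_field F j \<longleftrightarrow>
     (\<forall>x\<in>strip. j (F x) \<in> span {Fs F x, Ft F x}) \<and>
     (\<forall>s. \<forall>t\<in>{0, 1}. j (F (s, t)) \<in> span {Fs F (s, t)})"

definition area :: "(real \<times> real \<Rightarrow> R3) \<Rightarrow> R3 set \<Rightarrow> ennreal" where
  "area F S = (\<integral>\<^sup>+ x \<in> {x \<in> {0..<1} \<times> {0..1}. F x \<in> S}.
       ennreal (sqrt ((Fs F x \<bullet> Fs F x) * (Ft F x \<bullet> Ft F x) - (Fs F x \<bullet> Ft F x)\<^sup>2))
     \<partial>lebesgue)"

definition zero_area :: "(real \<times> real \<Rightarrow> R3) \<Rightarrow> R3 set \<Rightarrow> bool" where
  "zero_area F S \<longleftrightarrow> S \<subseteq> surf F \<and>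
     {x \<in> {0..<1} \<times> {0..1}. F x \<in> S} \<in> sets lebesgue \<and> area F S = 0"

definition orbit :: "R3 set \<Rightarrow> (R3 \<Rightarrow> R3) \<Rightarrow> R3 \<Rightarrow> (real \<Rightarrow> R3) \<Rightarrow> bool" where
  "orbit \<Sigma> j p \<gamma> \<longleftrightarrow> \<gamma> 0 = p \<and> (\<forall>t. \<gamma> t \<in> \<Sigma>) \<and>
     (\<forall>t. (\<gamma> has_vector_derivative j (\<gamma> t)) (at t))"

definition is_period :: "(real \<Rightarrow> R3) \<Rightarrow> real \<Rightarrow> bool" where
  "is_period \<gamma> T \<longleftrightarrow> T > 0 \<and> (\<forall>t. \<gamma> (t + T) = \<gamma> t)"

definition periodic_orbit :: "(real \<Rightarrow> R3) \<Rightarrow> bool" where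
  "periodic_orbit \<gamma> \<longleftrightarrow> (\<exists>T. is_period \<gamma> T)"

definition omega_limit :: "(real \<Rightarrow> R3) \<Rightarrow> R3 set" where
  "omega_limit \<gamma> = {q. \<exists>tk :: nat \<Rightarrow> real. filterlim tk at_top sequentially \<and>
                         ((\<lambda>k. \<gamma> (tk k)) \<longlonglongrightarrow> q)}"

end

(* The divergence-free field j, read in the coordinates of the annulus, is the rotated gradient of a
   stream function psi: the 1-form that j contracts from the area form is closed, and it is exact
   because it vanishes along the boundary circle t = 0. Orbits lie in level sets of psi, which near a
   zero-free point are single Lipschitz arcs, so an orbit that accumulates at a point q with j q nonzero
   passes through q itself again and again and is therefore periodic. A non-periodic orbit thus
   accumulates only at critical points of psi and lies at a critical level; by Sard's theorem for
   functions of class C^2 on the plane these levels form a null set, and so do the regular points on them.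
   Finally, a contractible periodic orbit would lift to a closed curve in the strip, and psi,
   being constant on a simple sub-loop, would have a critical point inside it by the Jordan curve theorem. *)
theory Submission
  imports Defs
begin

section \<open>Null sets of values: Sard in the plane\<close>

lemma negligible_image_superlinear:
  fixes \<pi> :: "'i \<Rightarrow> 'a::euclidean_space" and \<phi> :: "'i \<Rightarrow> real"
  assumes bdd: "bounded (\<pi> ` A)"
    and small: "\<And>e. e > 0 \<Longrightarrow> \<exists>d>0. \<forall>x\<in>A. \<forall>y\<in>A. dist (\<pi> x) (\<pi> y) < d \<longrightarrow>
                  \<bar>\<phi> x - \<phi> y\<bar> \<le> e * dist (\<pi> x) (\<pi> y) ^ DIM('a)"
  shows "negligible (\<phi> ` A)"
  unfolding negligible_outer_le
proof (intro allI impI)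
  fix e :: real assume e: "e > 0"
  define n where "n = DIM('a)"
  have n: "n > 0" by (simp add: n_def)
  obtain R0 where R0: "\<And>x. x \<in> A \<Longrightarrow> norm (\<pi> x) \<le> R0" using bdd by (auto simp: bounded_iff)
  obtain R :: nat where R: "R0 \<le> real R" using real_arch_simple by blast
  define e' where "e' = e / (2 * real (2 * R + 1) ^ n * real n ^ n)"
  have e': "e' > 0" using e n by (simp add: e'_def)
  obtain d where d: "d > 0" and dd: "\<And>x y. x \<in> A \<Longrightarrow> y \<in> A \<Longrightarrow> dist (\<pi> x) (\<pi> y) < d \<Longrightarrow>
                  \<bar>\<phi> x - \<phi> y\<bar> \<le> e' * dist (\<pi> x) (\<pi> y) ^ n"
    using small[OF e'] unfolding n_def by meson
  obtain N0 :: nat where N0: "real n / d < real N0" using reals_Archimedean2 by blast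
  define N where "N = Suc N0"
  have N: "N > 0" "real n / real N < d"
    using N0 d by (auto simp: N_def field_simps)
  define cell where "cell x = restrict (\<lambda>b. \<lfloor>real N * (\<pi> x \<bullet> b)\<rfloor>) Basis" for x
  define C where "C = (\<Pi>\<^sub>E b\<in>(Basis::'a set). {- int (N * R) .. int (N * R)})"
  have cellC: "cell ` A \<subseteq> C"
  proof clarsimp
    fix x assume x: "x \<in> A"
    show "cell x \<in> C" unfolding cell_def C_def
    proof (rule restrict_PiE_iff[THEN iffD2], rule ballI)
      fix b :: 'a assume b: "b \<in> Basis"
      have "\<bar>\<pi> x \<bullet> b\<bar> \<le> real R" using Basis_le_norm[OF b] R0[OF x] R by (meson order_trans)
      hence "\<bar>real N * (\<pi> x \<bullet> b)\<bar> \<le> real (N * R)"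
        by (simp add: abs_mult mult_left_mono)
      hence 1: "- real (N*R) \<le> real N * (\<pi> x \<bullet> b)" "real N * (\<pi> x \<bullet> b) \<le> real (N*R)" by linarith+
      have "- int (N*R) \<le> \<lfloor>real N * (\<pi> x \<bullet> b)\<rfloor>" using 1(1)
        by (metis le_floor_iff of_int_minus of_int_of_nat_eq)
      moreover have "\<lfloor>real N * (\<pi> x \<bullet> b)\<rfloor> \<le> int (N*R)" using 1(2)
        by (metis floor_mono floor_of_nat)
      ultimately show "\<lfloor>real N * (\<pi> x \<bullet> b)\<rfloor> \<in> {- int (N * R) .. int (N * R)}" by simp
    qed
  qed
  have finC: "finite C" unfolding C_def by (intro finite_PiE) auto
  hence fin: "finite (cell ` A)" using cellC finite_subset by blast
  have "card {- int (N * R) .. int (N * R)} = 2 * N * R + 1"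
    by (simp add: nat_eq_iff)
  hence "card C = (2 * N * R + 1) ^ n"
    unfolding C_def n_def by (subst card_PiE) (simp_all del: card_atLeastAtMost_int)
  hence card: "card (cell ` A) \<le> (2 * N * R + 1) ^ n"
    using card_mono[OF finC cellC] by simp
  define \<eta> where "\<eta> = e' * (real n / real N) ^ n"
  have \<eta>0: "\<eta> \<ge> 0" using e' by (simp add: \<eta>_def)
  have same: "\<bar>\<phi> x - \<phi> y\<bar> \<le> \<eta>" if x: "x \<in> A" and y: "y \<in> A" and eq: "cell x = cell y" for x y
  proof -
    have "\<bar>(\<pi> x - \<pi> y) \<bullet> b\<bar> \<le> 1 / real N" if b: "b \<in> Basis" for b
    proof -
      have "\<lfloor>real N * (\<pi> x \<bullet> b)\<rfloor> = \<lfloor>real N * (\<pi> y \<bullet> b)\<rfloor>"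
        using fun_cong[OF eq, of b] b by (simp add: cell_def)
      hence "\<bar>real N * (\<pi> x \<bullet> b) - real N * (\<pi> y \<bullet> b)\<bar> \<le> 1" by linarith
      hence "real N * \<bar>(\<pi> x - \<pi> y) \<bullet> b\<bar> \<le> 1"
        by (metis abs_mult abs_of_nat inner_diff_left right_diff_distrib)
      thus ?thesis using N by (simp add: field_simps)
    qed
    hence "(\<Sum>b\<in>Basis. \<bar>(\<pi> x - \<pi> y) \<bullet> b\<bar>) \<le> (\<Sum>b\<in>(Basis::'a set). 1 / real N)"
      by (rule sum_mono)
    hence "dist (\<pi> x) (\<pi> y) \<le> real n / real N"
      using norm_le_l1[of "\<pi> x - \<pi> y"] by (simp add: dist_norm n_def)
    hence "\<bar>\<phi> x - \<phi> y\<bar> \<le> e' * dist (\<pi> x) (\<pi> y) ^ n" "dist (\<pi> x) (\<pi> y) ^ n \<le> (real n / real N) ^ n"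
      using dd[OF x y] N by (auto intro: power_mono)
    thus ?thesis unfolding \<eta>_def using e' by (meson mult_left_mono order_trans less_imp_le)
  qed
  define pick where "pick c = (SOME x. x \<in> A \<and> cell x = c)" for c
  have pick: "pick (cell x) \<in> A \<and> cell (pick (cell x)) = cell x" if "x \<in> A" for x
    unfolding pick_def by (rule someI[of _ x]) (use that in auto)
  define T where "T = (\<Union>c\<in>cell ` A. cbox (\<phi> (pick c) - \<eta>) (\<phi> (pick c) + \<eta>))"
  have "\<phi> ` A \<subseteq> T"
  proof
    fix v assume "v \<in> \<phi> ` A"
    then obtain x where x: "x \<in> A" "v = \<phi> x" by blast
    have "\<bar>\<phi> x - \<phi> (pick (cell x))\<bar> \<le> \<eta>" using same pick x by auto
    thus "v \<in> T" unfolding T_def using x by (auto simp: abs_le_iff intro!: bexI[of _ x])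
  qed
  moreover have Tm: "T \<in> lmeasurable" unfolding T_def by (intro fmeasurable.finite_UN fin) auto
  moreover have "measure lebesgue T \<le> e"
  proof -
    have "measure lebesgue T \<le> (\<Sum>c\<in>cell ` A. measure lebesgue (cbox (\<phi> (pick c) - \<eta>) (\<phi> (pick c) + \<eta>)))"
      unfolding T_def by (intro measure_UNION_le fin) auto
    also have "\<dots> = real (card (cell ` A)) * (2 * \<eta>)" using \<eta>0 by simp
    also have "\<dots> \<le> real ((2 * N * R + 1) ^ n) * (2 * \<eta>)"
      using card \<eta>0 by (intro mult_right_mono) (auto simp: of_nat_le_iff simp del: of_nat_power)
    also have "\<dots> \<le> real ((N * (2 * R + 1)) ^ n) * (2 * \<eta>)"
      using N \<eta>0 by (intro mult_right_mono of_nat_mono power_mono) (auto simp: algebra_simps)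
    also have "\<dots> = e"
    proof -
      define k where "k = real (2 * R + 1)"
      have k: "k > 0" by (simp add: k_def)
      have "real ((N * (2 * R + 1)) ^ n) = real N ^ n * k ^ n"
        by (simp only: k_def of_nat_power of_nat_mult power_mult_distrib)
      moreover have "\<eta> = e / (2 * k ^ n * real N ^ n)"
        using n N by (simp add: \<eta>_def e'_def k_def power_divide del: of_nat_add of_nat_mult)
      ultimately show ?thesis using N k by simp
    qed
    finally show ?thesis .
  qed
  ultimately show "\<exists>T. \<phi> ` A \<subseteq> T \<and> T \<in> lmeasurable \<and> measure lebesgue T \<le> e" by blast
qed

lemma negligible_image_locally:
  fixes f :: "'a::euclidean_space \<Rightarrow> 'b::euclidean_space"
  assumes "\<And>x. x \<in> S \<Longrightarrow> \<exists>V. open V \<and> x \<in> V \<and> negligible (f ` (S \<inter> V))"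
  shows "negligible (f ` S)"
proof -
  define \<F> where "\<F> = {V. open V \<and> negligible (f ` (S \<inter> V))}"
  obtain \<F>' where F': "\<F>' \<subseteq> \<F>" "countable \<F>'" "\<Union>\<F>' = \<Union>\<F>"
    using Lindelof[of \<F>] unfolding \<F>_def by blast
  have "S \<subseteq> \<Union>\<F>'" using assms unfolding F'(3) \<F>_def by blast
  hence "f ` S \<subseteq> \<Union>((\<lambda>V. f ` (S \<inter> V)) ` \<F>')" by blast
  moreover have "negligible (\<Union>((\<lambda>V. f ` (S \<inter> V)) ` \<F>'))"
    using F' by (intro negligible_countable_Union) (auto simp: \<F>_def)
  ultimately show ?thesis by (rule negligible_subset[rotated])
qed

lemma linear_norm_bound_Basis:
  fixes L :: "'a::euclidean_space \<Rightarrow> 'b::real_normed_vector"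
  assumes "linear L" "\<And>b. b \<in> Basis \<Longrightarrow> norm (L b) \<le> c"
  shows "norm (L h) \<le> c * DIM('a) * norm h"
proof -
  have "L h = (\<Sum>b\<in>Basis. (h \<bullet> b) *\<^sub>R L b)"
    using assms(1) by (subst euclidean_representation[of h, symmetric])
      (simp add: linear_sum linear_cmul)
  also have "norm \<dots> \<le> (\<Sum>b\<in>(Basis::'a set). norm h * c)"
  proof (intro sum_norm_le)
    fix b :: 'a assume b: "b \<in> Basis"
    show "norm ((h \<bullet> b) *\<^sub>R L b) \<le> norm h * c"
      using Basis_le_norm[OF b, of h] assms(2)[OF b] by (auto intro: mult_mono)
  qed
  finally show ?thesis by (simp add: algebra_simps)
qed

lemma C1_uniform_derivative:
  fixes Dg :: "'a::euclidean_space \<Rightarrow> 'a \<Rightarrow> 'b::real_normed_vector"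
  assumes "compact K" and "K \<subseteq> U"
    and der: "\<And>x. x \<in> U \<Longrightarrow> linear (Dg x)"
    and cont: "\<And>h. continuous_on U (\<lambda>x. Dg x h)" and e: "e > 0"
  obtains d where "d > 0"
    "\<And>x y h. x \<in> K \<Longrightarrow> y \<in> K \<Longrightarrow> dist x y < d \<Longrightarrow> norm (Dg x h - Dg y h) \<le> e * norm h"
proof -
  have "uniformly_continuous_on K (\<lambda>x. Dg x b)" for b
    using assms by (meson compact_uniformly_continuous continuous_on_subset)
  hence "\<exists>d>0. \<forall>x\<in>K. \<forall>y\<in>K. dist y x < d \<longrightarrow> dist (Dg y b) (Dg x b) < e / DIM('a)" for b
    using e unfolding uniformly_continuous_on_def by (simp add: divide_pos_pos)
  then obtain d :: "'a \<Rightarrow> real" where d: "\<And>b. d b > 0"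
    and dd: "\<And>b x y. x \<in> K \<Longrightarrow> y \<in> K \<Longrightarrow> dist y x < d b \<Longrightarrow> dist (Dg y b) (Dg x b) < e / DIM('a)"
    by metis
  define d0 where "d0 = Min (d ` (Basis::'a set))"
  show thesis
  proof (rule that[of d0])
    show "d0 > 0" using d by (simp add: d0_def)
    fix x y :: 'a and h :: 'a assume K: "x \<in> K" "y \<in> K" and dist: "dist x y < d0"
    have lin: "linear (\<lambda>h. Dg x h - Dg y h)"
      using der K assms by (intro linear_compose_sub) auto
    have "norm (Dg x b - Dg y b) \<le> e / DIM('a)" if "b \<in> Basis" for b
    proof -
      have "dist x y < d b" using dist that by (simp add: d0_def)
      thus ?thesis using dd[OF K(2,1)] by (simp add: dist_norm less_imp_le)
    qed
    from linear_norm_bound_Basis[OF lin this, of h]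
    show "norm (Dg x h - Dg y h) \<le> e * norm h" by simp
  qed
qed

lemma C1_strict_derivative:
  fixes g :: "'a::euclidean_space \<Rightarrow> 'b::real_normed_vector"
  assumes "open U" and der: "\<And>x. x \<in> U \<Longrightarrow> (g has_derivative Dg x) (at x)"
    and cont: "\<And>h. continuous_on U (\<lambda>x. Dg x h)" and "x0 \<in> U" and e: "e > 0"
  obtains r where "r > 0" "ball x0 r \<subseteq> U"
    "\<And>x y. x \<in> ball x0 r \<Longrightarrow> y \<in> ball x0 r \<Longrightarrow> norm (g x - g y - Dg x0 (x - y)) \<le> e * norm (x - y)"
proof -
  have lin: "\<And>x. x \<in> U \<Longrightarrow> linear (Dg x)" using der has_derivative_linear by blast
  obtain s where s: "s > 0" "cball x0 s \<subseteq> U" using assms open_contains_cball by metis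
  obtain d where d: "d > 0" and dd: "\<And>x y h. x \<in> cball x0 s \<Longrightarrow> y \<in> cball x0 s \<Longrightarrow> dist x y < d \<Longrightarrow> norm (Dg x h - Dg y h) \<le> e * norm h"
    using C1_uniform_derivative[OF compact_cball s(2) lin cont e] by blast
  define r where "r = min d s"
  show thesis
  proof (rule that[of r])
    show "r > 0" using d s by (simp add: r_def)
    show sub: "ball x0 r \<subseteq> U" using s by (auto simp: r_def)
    fix x y assume xy: "x \<in> ball x0 r" "y \<in> ball x0 r"
    have l0: "bounded_linear (Dg x0)" using der assms has_derivative_bounded_linear by blast
    have "norm ((g x - Dg x0 x) - (g y - Dg x0 y)) \<le> e * norm (x - y)"
    proof (rule differentiable_bound[where S="ball x0 r" and f'="\<lambda>z h. Dg z h - Dg x0 h"])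
      fix z assume z: "z \<in> ball x0 r"
      show "((\<lambda>a. g a - Dg x0 a) has_derivative (\<lambda>h. Dg z h - Dg x0 h)) (at z within ball x0 r)"
        by (intro has_derivative_diff bounded_linear.has_derivative[OF l0] has_derivative_ident
              has_derivative_at_withinI[OF der]) (use sub z in blast)
      show "onorm (\<lambda>h. Dg z h - Dg x0 h) \<le> e"
        using dd[of z x0] z s e by (intro onorm_le) (auto simp: r_def dist_commute)
    qed (use xy in auto)
    moreover have "(g x - Dg x0 x) - (g y - Dg x0 y) = g x - g y - Dg x0 (x - y)"
      using lin[OF \<open>x0 \<in> U\<close>] by (simp add: linear_diff)
    ultimately show "norm (g x - g y - Dg x0 (x - y)) \<le> e * norm (x - y)" by simp
  qed
qed

lemma critical_value_quadratic:
  fixes f :: "'a::euclidean_space \<Rightarrow> real"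
  assumes der: "\<And>z. z \<in> closed_segment x y \<Longrightarrow> (f has_derivative (\<lambda>h. g z \<bullet> h)) (at z)"
    and lip: "\<And>z. z \<in> closed_segment x y \<Longrightarrow> norm (g z) \<le> K * norm (z - y)" and K: "K \<ge> 0"
  shows "\<bar>f x - f y\<bar> \<le> K * (norm (x - y))\<^sup>2"
proof -
  have "norm (f x - f y) \<le> (K * norm (x - y)) * norm (x - y)"
  proof (rule differentiable_bound[where S="closed_segment x y" and f'="\<lambda>z h. g z \<bullet> h"])
    fix z assume z: "z \<in> closed_segment x y"
    show "(f has_derivative (\<lambda>h. g z \<bullet> h)) (at z within closed_segment x y)"
      using der[OF z] has_derivative_at_withinI by blast
    have "norm (z - y) \<le> norm (x - y)" using z segment_bound(2)[of z x y]
      by (simp add: norm_minus_commute)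
    hence "norm (g z) \<le> K * norm (x - y)" using lip[OF z] K by (meson mult_left_mono order_trans)
    thus "onorm (\<lambda>h. g z \<bullet> h) \<le> K * norm (x - y)"
      using Cauchy_Schwarz_ineq2[of "g z"]
      by (intro onorm_le) (metis mult_right_mono norm_ge_zero order_trans real_norm_def)
  qed auto
  thus ?thesis by (simp add: power2_eq_square mult.assoc)
qed

lemma Sard_degenerate_local:
  fixes f :: "real \<times> real \<Rightarrow> real" and g :: "real \<times> real \<Rightarrow> real \<times> real"
  assumes "open U" and f: "\<And>x. x \<in> U \<Longrightarrow> (f has_derivative (\<lambda>h. g x \<bullet> h)) (at x)"
    and g: "\<And>x. x \<in> U \<Longrightarrow> (g has_derivative Dg x) (at x)"
    and cont: "\<And>h. continuous_on U (\<lambda>x. Dg x h)" and x0: "x0 \<in> U"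
  obtains V where "open V" "x0 \<in> V" "negligible (f ` ({x \<in> U. g x = 0 \<and> Dg x = (\<lambda>h. 0)} \<inter> V))"
proof -
  obtain s where s: "s > 0" "cball x0 s \<subseteq> U" using assms open_contains_cball by metis
  have lin: "\<And>x. x \<in> U \<Longrightarrow> linear (Dg x)" using g has_derivative_linear by blast
  show thesis
  proof (rule that[of "ball x0 s"])
    let ?A = "{x \<in> U. g x = 0 \<and> Dg x = (\<lambda>h. 0)} \<inter> ball x0 s"
    show "negligible (f ` ?A)"
    proof (rule negligible_image_superlinear[where \<pi>="\<lambda>x. x"])
      show "bounded ((\<lambda>x. x) ` ?A)" by (auto intro: bounded_subset[OF bounded_ball])
      fix e :: real assume e: "e > 0"
      obtain d where d: "d > 0" and dd: "\<And>x y h. x \<in> cball x0 s \<Longrightarrow> y \<in> cball x0 s \<Longrightarrow> dist x y < d \<Longrightarrow> norm (Dg x h - Dg y h) \<le> e * norm h"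
        using C1_uniform_derivative[OF compact_cball s(2) lin cont e] by blast
      have "\<bar>f x - f y\<bar> \<le> e * dist x y ^ DIM(real \<times> real)"
        if x: "x \<in> ?A" and y: "y \<in> ?A" and xy: "dist x y < d" for x y
      proof -
        have seg: "z \<in> cball x0 s \<and> dist z y < d" if "z \<in> closed_segment x y" for z
        proof
          show "z \<in> cball x0 s" using x y that closed_segment_subset[of x "ball x0 s" y] by fastforce
          show "dist z y < d" using segment_bound(2)[OF that] xy by (simp add: dist_norm norm_minus_commute)
        qed
        have "norm (g z) \<le> e * norm (z - y)" if z: "z \<in> closed_segment x y" for z
        proof -
          have "norm (g z - g y) \<le> e * norm (z - y)"
          proof (rule differentiable_bound[where S="closed_segment x y" and f'=Dg])
            fix w assume w: "w \<in> closed_segment x y"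
            show "(g has_derivative Dg w) (at w within closed_segment x y)"
              by (rule has_derivative_at_withinI[OF g]) (use seg[OF w] s in blast)
            show "onorm (Dg w) \<le> e"
              using dd[of w y] seg[OF w] y by (intro onorm_le) auto
          qed (use z in auto)
          thus ?thesis using y by simp
        qed
        moreover have "(f has_derivative (\<lambda>h. g z \<bullet> h)) (at z)" if "z \<in> closed_segment x y" for z
          using f seg[OF that] s by blast
        ultimately show ?thesis using critical_value_quadratic[of x y f g e] e
          by (simp add: dist_norm power2_eq_square)
      qed
      thus "\<exists>d>0. \<forall>x\<in>?A. \<forall>y\<in>?A. dist x y < d \<longrightarrow> \<bar>f x - f y\<bar> \<le> e * dist x y ^ DIM(real \<times> real)"
        using d by blast
    qed
  qed (use s in auto)
qed

lemma Sard_nondegenerate_local: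
  fixes f :: "real \<times> real \<Rightarrow> real" and g :: "real \<times> real \<Rightarrow> real \<times> real"
  assumes "open U" and f: "\<And>x. x \<in> U \<Longrightarrow> (f has_derivative (\<lambda>h. g x \<bullet> h)) (at x)"
    and g: "\<And>x. x \<in> U \<Longrightarrow> (g has_derivative Dg x) (at x)"
    and cont: "\<And>h. continuous_on U (\<lambda>x. Dg x h)" and x0: "x0 \<in> U"
    and nz: "Dg x0 \<noteq> (\<lambda>h. 0)"
  obtains V where "open V" "x0 \<in> V" "negligible (f ` ({x \<in> U. g x = 0} \<inter> V))"
proof -
  have lin: "linear (Dg x0)" using g x0 has_derivative_linear by blast
  obtain h0 where "Dg x0 h0 \<noteq> 0" using nz by fastforce
  then obtain u :: "real \<times> real" where u: "u \<in> Basis" "Dg x0 h0 \<bullet> u \<noteq> 0"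
    using euclidean_all_zero_iff by blast
  define m1 where "m1 = Dg x0 (1,0) \<bullet> u"
  define m2 where "m2 = Dg x0 (0,1) \<bullet> u"
  have Du: "Dg x0 h \<bullet> u = m1 * fst h + m2 * snd h" for h
  proof -
    have "Dg x0 h = Dg x0 (fst h *\<^sub>R (1,0) + snd h *\<^sub>R (0,1))" by simp
    also have "\<dots> = fst h *\<^sub>R Dg x0 (1,0) + snd h *\<^sub>R Dg x0 (0,1)"
      by (simp only: linear_add[OF lin] linear_cmul[OF lin])
    finally have "Dg x0 h = fst h *\<^sub>R Dg x0 (1,0) + snd h *\<^sub>R Dg x0 (0,1)" .
    thus ?thesis by (simp add: m1_def m2_def inner_add_left)
  qed
  define \<mu> where "\<mu> = sqrt (m1\<^sup>2 + m2\<^sup>2)"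
  have "m1 \<noteq> 0 \<or> m2 \<noteq> 0" using u Du[of h0] by auto
  hence \<mu>: "\<mu> > 0" unfolding \<mu>_def by (simp only: real_sqrt_gt_0_iff sum_power2_gt_zero_iff)
  have \<mu>2: "\<mu>\<^sup>2 = m1\<^sup>2 + m2\<^sup>2" by (simp add: \<mu>_def)
  obtain r where r: "r > 0" "ball x0 r \<subseteq> U" and strict:
    "\<And>x y. x \<in> ball x0 r \<Longrightarrow> y \<in> ball x0 r \<Longrightarrow> norm (g x - g y - Dg x0 (x - y)) \<le> (\<mu>/2) * norm (x - y)"
    using C1_strict_derivative[OF \<open>open U\<close> g cont x0, of "\<mu>/2"] \<mu> by auto
  obtain B where B: "B > 0" "\<And>h. norm (Dg x0 h) \<le> B * norm h"
    using linear_bounded_pos[OF lin] by blast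
  define K where "K = B + \<mu>/2"
  have K: "K > 0" using B \<mu> by (simp add: K_def)
  define \<pi> where "\<pi> z = m1 * snd z - m2 * fst z" for z :: "real \<times> real"
  let ?A = "{x \<in> U. g x = 0} \<inter> ball x0 r"
  have quad: "\<bar>f x - f y\<bar> \<le> K * (norm (x - y))\<^sup>2" if x: "x \<in> ?A" and y: "y \<in> ?A" for x y
  proof (rule critical_value_quadratic[where g=g])
    fix z assume "z \<in> closed_segment x y"
    hence z: "z \<in> ball x0 r" using x y closed_segment_subset[of x "ball x0 r" y] by auto
    show "(f has_derivative (\<lambda>h. g z \<bullet> h)) (at z)" by (rule f) (use z r in blast)
    have "norm (g z) \<le> norm (g z - g y - Dg x0 (z - y)) + norm (Dg x0 (z - y))"
      using y norm_triangle_ineq[of "g z - g y - Dg x0 (z - y)" "Dg x0 (z - y)"] by simp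
    also have "\<dots> \<le> (\<mu>/2) * norm (z - y) + B * norm (z - y)"
      by (intro add_mono strict B) (use z y in blast)+
    finally show "norm (g z) \<le> K * norm (z - y)" by (simp add: K_def ring_distribs add.commute)
  qed (use K in auto)
  have proj: "norm (x - y) \<le> (2/\<mu>) * \<bar>\<pi> x - \<pi> y\<bar>" if x: "x \<in> ?A" and y: "y \<in> ?A" for x y
  proof -
    define h where "h = x - y"
    have "\<bar>(g x - g y - Dg x0 (x - y)) \<bullet> u\<bar> \<le> (\<mu>/2) * norm h"
      unfolding h_def by (rule order_trans[OF Basis_le_norm[OF u(1)] strict]) (use x y in blast)+
    hence 1: "\<bar>m1 * fst h + m2 * snd h\<bar> \<le> (\<mu>/2) * norm h"
      using x y by (simp add: h_def[symmetric] inner_minus_left abs_minus_cancel del: minus_add_distrib flip: Du)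
    have "\<mu>\<^sup>2 * (norm h)\<^sup>2 = (m1 * fst h + m2 * snd h)\<^sup>2 + (\<pi> h)\<^sup>2"
      unfolding \<mu>2 by (cases h) (simp add: norm_Pair \<pi>_def, simp add: power2_eq_square algebra_simps)
    also have "(m1 * fst h + m2 * snd h)\<^sup>2 \<le> ((\<mu>/2) * norm h)\<^sup>2"
      using power_mono[OF 1 abs_ge_zero, of 2] by simp
    finally have "\<mu>\<^sup>2 * (norm h)\<^sup>2 \<le> ((\<mu>/2) * norm h)\<^sup>2 + (\<pi> h)\<^sup>2" by simp
    hence "3 * (\<mu> * norm h)\<^sup>2 \<le> 4 * (\<pi> h)\<^sup>2" by (simp add: power_mult_distrib power_divide)
    hence "(\<mu> * norm h)\<^sup>2 \<le> (2 * \<pi> h)\<^sup>2" 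
      using zero_le_power2[of "\<mu> * norm h"] unfolding power_mult_distrib[of 2] power2_eq_square[of 2] by linarith
    hence "\<mu> * norm h \<le> \<bar>2 * \<pi> h\<bar>"
      unfolding abs_le_square_iff[symmetric] using \<mu> by simp
    moreover have "\<pi> h = \<pi> x - \<pi> y" by (simp add: \<pi>_def h_def algebra_simps)
    ultimately have "\<mu> * norm (x - y) \<le> 2 * \<bar>\<pi> x - \<pi> y\<bar>" by (simp add: h_def abs_mult)
    thus ?thesis using \<mu> by (simp add: field_simps)
  qed
  show thesis
  proof (rule that[of "ball x0 r"])
    show "negligible (f ` ?A)"
    proof (rule negligible_image_superlinear[where \<pi>=\<pi>])
      have "linear \<pi>" by (rule linearI) (auto simp: \<pi>_def algebra_simps)
      moreover have "bounded ?A" by (auto intro: bounded_subset[OF bounded_ball])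
      ultimately show "bounded (\<pi> ` ?A)" using bounded_linear_image linear_conv_bounded_linear by blast
      fix e :: real assume e: "e > 0"
      define C where "C = K * (2/\<mu>)\<^sup>2"
      have C: "C > 0" using K \<mu> by (simp add: C_def)
      have "\<bar>f x - f y\<bar> \<le> e * dist (\<pi> x) (\<pi> y) ^ DIM(real)"
        if x: "x \<in> ?A" and y: "y \<in> ?A" and xy: "dist (\<pi> x) (\<pi> y) < e / C" for x y
      proof -
        have "\<bar>f x - f y\<bar> \<le> K * ((2/\<mu>) * \<bar>\<pi> x - \<pi> y\<bar>)\<^sup>2"
          using quad[OF x y] power_mono[OF proj[OF x y], of 2] K
          by (meson mult_left_mono order_trans norm_ge_zero less_imp_le)
        also have "\<dots> = (C * dist (\<pi> x) (\<pi> y)) * dist (\<pi> x) (\<pi> y)"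
          by (simp add: C_def power_mult_distrib dist_real_def power2_eq_square)
        also have "\<dots> \<le> e * dist (\<pi> x) (\<pi> y)"
          using xy C by (intro mult_right_mono) (auto simp: field_simps)
        finally show ?thesis by simp
      qed
      thus "\<exists>d>0. \<forall>x\<in>?A. \<forall>y\<in>?A. dist (\<pi> x) (\<pi> y) < d \<longrightarrow> \<bar>f x - f y\<bar> \<le> e * dist (\<pi> x) (\<pi> y) ^ DIM(real)"
        using e C by (meson divide_pos_pos)
    qed
  qed (use r in auto)
qed

lemma Sard_plane:
  fixes f :: "real \<times> real \<Rightarrow> real" and g :: "real \<times> real \<Rightarrow> real \<times> real"
  assumes "open U" and "\<And>x. x \<in> U \<Longrightarrow> (f has_derivative (\<lambda>h. g x \<bullet> h)) (at x)"
    and "\<And>x. x \<in> U \<Longrightarrow> (g has_derivative Dg x) (at x)"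
    and "\<And>h. continuous_on U (\<lambda>x. Dg x h)"
  shows "negligible (f ` {x \<in> U. g x = 0})"
proof (rule negligible_subset)
  let ?A = "{x \<in> U. g x = 0 \<and> Dg x \<noteq> (\<lambda>h. 0)}" and ?B = "{x \<in> U. g x = 0 \<and> Dg x = (\<lambda>h. 0)}"
  show "f ` {x \<in> U. g x = 0} \<subseteq> f ` ?A \<union> f ` ?B" by blast
  have "negligible (f ` ?A)"
  proof (rule negligible_image_locally)
    fix x assume x: "x \<in> ?A"
    then obtain V where "open V" "x \<in> V" "negligible (f ` ({x \<in> U. g x = 0} \<inter> V))"
      using Sard_nondegenerate_local[OF assms, of x] by auto
    moreover have "f ` (?A \<inter> V) \<subseteq> f ` ({x \<in> U. g x = 0} \<inter> V)" by blast
    ultimately show "\<exists>V. open V \<and> x \<in> V \<and> negligible (f ` (?A \<inter> V))" by (meson negligible_subset)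
  qed
  moreover have "negligible (f ` ?B)"
    by (rule negligible_image_locally) (use Sard_degenerate_local[OF assms] in blast)
  ultimately show "negligible (f ` ?A \<union> f ` ?B)" by simp
qed

lemma negligible_Times_UNIV:
  fixes Z :: "real set"
  assumes "negligible Z"
  shows "negligible (Z \<times> (UNIV :: real set))"
proof -
  obtain N where N: "N \<in> null_sets lborel" "Z \<subseteq> N"
    using assms by (auto simp: negligible_iff_null_sets null_sets_completion_iff2)
  have "N \<times> (UNIV :: real set) \<in> null_sets (lborel \<Otimes>\<^sub>M lborel)"
    using N by (intro null_setsI) (auto simp: lborel.emeasure_pair_measure_Times null_sets_def)
  hence "N \<times> (UNIV :: real set) \<in> null_sets lborel" by (simp add: lborel_prod)
  hence "negligible (N \<times> (UNIV :: real set))"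
    by (simp add: negligible_iff_null_sets null_sets_completionI)
  thus ?thesis by (rule negligible_subset) (use N in auto)
qed

lemma negligible_regular_preimage:
  fixes f :: "real \<times> real \<Rightarrow> real" and g :: "real \<times> real \<Rightarrow> real \<times> real"
  assumes f: "\<And>x. x \<in> S \<Longrightarrow> (f has_derivative (\<lambda>h. g x \<bullet> h)) (at x within S)"
    and Z: "negligible Z"
  shows "negligible {x \<in> S. g x \<noteq> 0 \<and> f x \<in> Z}"
proof (rule negligible_subset)
  let ?S1 = "{x \<in> S. fst (g x) \<noteq> 0}" and ?S2 = "{x \<in> S. snd (g x) \<noteq> 0}"
  let ?Z = "Z \<times> (UNIV :: real set)"
  show "{x \<in> S. g x \<noteq> 0 \<and> f x \<in> Z} \<subseteq> {x \<in> ?S1. (f x, snd x) \<in> ?Z} \<union> {x \<in> ?S2. (f x, fst x) \<in> ?Z}"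
    by (auto simp: prod_eq_iff)
  have "negligible {x \<in> ?S1. (f x, snd x) \<in> ?Z}"
  proof (rule negligible_differentiable_vimage[OF negligible_Times_UNIV[OF Z], where f'="\<lambda>x h. (g x \<bullet> h, snd h)"])
    fix x assume x: "x \<in> ?S1"
    show "inj (\<lambda>h. (g x \<bullet> h, snd h))" using x by (cases "g x") (auto simp: inj_def)
    have "(f has_derivative (\<lambda>h. g x \<bullet> h)) (at x within ?S1)"
      by (rule has_derivative_subset[OF f]) (use x in auto)
    thus "((\<lambda>x. (f x, snd x)) has_derivative (\<lambda>h. (g x \<bullet> h, snd h))) (at x within ?S1)"
      by (auto intro!: derivative_eq_intros)
  qed
  moreover have "negligible {x \<in> ?S2. (f x, fst x) \<in> ?Z}"
  proof (rule negligible_differentiable_vimage[OF negligible_Times_UNIV[OF Z], where f'="\<lambda>x h. (g x \<bullet> h, fst h)"])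
    fix x assume x: "x \<in> ?S2"
    show "inj (\<lambda>h. (g x \<bullet> h, fst h))" using x by (cases "g x") (auto simp: inj_def)
    have "(f has_derivative (\<lambda>h. g x \<bullet> h)) (at x within ?S2)"
      by (rule has_derivative_subset[OF f]) (use x in auto)
    thus "((\<lambda>x. (f x, fst x)) has_derivative (\<lambda>h. (g x \<bullet> h, fst h))) (at x within ?S2)"
      by (auto intro!: derivative_eq_intros)
  qed
  ultimately show "negligible ({x \<in> ?S1. (f x, snd x) \<in> ?Z} \<union> {x \<in> ?S2. (f x, fst x) \<in> ?Z})" by simp
qed

section \<open>Potentials of closed 1-forms on the strip\<close>

lemma smooth_C2:
  fixes f :: "'a::euclidean_space \<Rightarrow> 'b::real_normed_vector"
  assumes "smooth f"
  obtains f1 :: "'a \<Rightarrow> 'a \<Rightarrow> 'b" and f2 :: "'a \<Rightarrow> 'a \<Rightarrow> 'a \<Rightarrow> 'b"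
  where "\<And>x. (f has_derivative f1 x) (at x)"
    and "\<And>x h. ((\<lambda>x. f1 x h) has_derivative (\<lambda>k. f2 x k h)) (at x)"
    and "\<And>h. continuous_on UNIV (\<lambda>x. f1 x h)"
    and "\<And>k h. continuous_on UNIV (\<lambda>x. f2 x k h)"
proof -
  obtain D where D0: "D [] = f" and D: "\<And>vs x. (D vs has_derivative (\<lambda>h. D (h # vs) x)) (at x)"
    using assms unfolding smooth_def by auto
  have cont: "continuous_on UNIV (D vs)" for vs
    using D has_derivative_continuous by (blast intro: continuous_at_imp_continuous_on)
  show thesis
  proof (rule that[of "\<lambda>x h. D [h] x" "\<lambda>x k h. D [k, h] x"])
    show "(f has_derivative (\<lambda>h. D [h] x)) (at x)" for x using D[of "[]"] by (simp add: D0)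
    show "((\<lambda>x. D [h] x) has_derivative (\<lambda>k. D [k, h] x)) (at x)" for x h using D[of "[h]"] by simp
    show "continuous_on UNIV (\<lambda>x. D [h] x)" for h using cont by simp
    show "continuous_on UNIV (\<lambda>x. D [k, h] x)" for k h using cont by simp
  qed
qed

lemma continuous_on_apply_linear:
  fixes L :: "'c::topological_space \<Rightarrow> 'a::euclidean_space \<Rightarrow> 'b::real_normed_vector"
  assumes "\<And>h. continuous_on S (\<lambda>x. L x h)" and "\<And>x. x \<in> S \<Longrightarrow> linear (L x)" and "continuous_on S q"
  shows "continuous_on S (\<lambda>x. L x (q x))"
proof -
  have "L x (q x) = (\<Sum>b\<in>Basis. (q x \<bullet> b) *\<^sub>R L x b)" if "x \<in> S" for x
    using assms(2)[OF that] by (subst euclidean_representation[of "q x", symmetric])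
      (simp add: linear_sum linear_cmul)
  moreover have "continuous_on S (\<lambda>x. \<Sum>b\<in>Basis. (q x \<bullet> b) *\<^sub>R L x b)"
    by (intro continuous_intros assms)
  ultimately show ?thesis by (simp cong: continuous_on_cong)
qed

lemma has_vector_derivative_fst_slice:
  assumes "(f has_derivative f') (at (s, t))"
  shows "((\<lambda>s. f (s, t)) has_vector_derivative f' (1, 0)) (at s)"
proof -
  have "((f \<circ> (\<lambda>s. (s, t))) has_derivative (f' \<circ> (\<lambda>h. (h, 0)))) (at s)"
    by (rule diff_chain_at[OF has_derivative_Pair[OF has_derivative_ident has_derivative_const]]) (rule assms)
  moreover have "f' \<circ> (\<lambda>h. (h, 0)) = (\<lambda>h. h *\<^sub>R f' (1, 0))"
  proof
    fix h
    have "(f' \<circ> (\<lambda>h. (h, 0))) h = f' (h *\<^sub>R (1, 0))" by simp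
    also have "\<dots> = h *\<^sub>R f' (1, 0)" by (rule linear_cmul[OF has_derivative_linear[OF assms]])
    finally show "(f' \<circ> (\<lambda>h. (h, 0))) h = h *\<^sub>R f' (1, 0)" .
  qed
  ultimately show ?thesis by (simp add: has_vector_derivative_def comp_def[of f])
qed

lemma has_vector_derivative_snd_slice:
  assumes "(f has_derivative f') (at (s, t))"
  shows "((\<lambda>t. f (s, t)) has_vector_derivative f' (0, 1)) (at t)"
proof -
  have "((f \<circ> (\<lambda>t. (s, t))) has_derivative (f' \<circ> (\<lambda>h. (0, h)))) (at t)"
    by (rule diff_chain_at[OF has_derivative_Pair[OF has_derivative_const has_derivative_ident]]) (rule assms)
  moreover have "f' \<circ> (\<lambda>h. (0, h)) = (\<lambda>h. h *\<^sub>R f' (0, 1))"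
  proof
    fix h
    have "(f' \<circ> (\<lambda>h. (0, h))) h = f' (h *\<^sub>R (0, 1))" by simp
    also have "\<dots> = h *\<^sub>R f' (0, 1)" by (rule linear_cmul[OF has_derivative_linear[OF assms]])
    finally show "(f' \<circ> (\<lambda>h. (0, h))) h = h *\<^sub>R f' (0, 1)" .
  qed
  ultimately show ?thesis by (simp add: has_vector_derivative_def comp_def[of f])
qed

lemma has_vector_derivative_integral_parameter:
  fixes B :: "real \<times> real \<Rightarrow> 'b::euclidean_space"
  assumes B: "\<And>s t. t \<in> {c..d} \<Longrightarrow> (B has_derivative B' (s, t)) (at (s, t))"
    and cont: "continuous_on (UNIV \<times> {c..d}) (\<lambda>x. B' x (1, 0))"
    and t: "t \<in> {c..d}"
  shows "((\<lambda>s. integral {c..t} (\<lambda>\<tau>. B (s, \<tau>))) has_vector_derivative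
          integral {c..t} (\<lambda>\<tau>. B' (s, \<tau>) (1, 0))) (at s)"
proof -
  have "((\<lambda>s. integral (cbox c t) (\<lambda>\<tau>. B (s, \<tau>))) has_vector_derivative
          integral (cbox c t) (\<lambda>\<tau>. B' (s, \<tau>) (1, 0))) (at s within UNIV)"
  proof (rule leibniz_rule_vector_derivative)
    fix x \<tau> assume \<tau>: "\<tau> \<in> cbox c t"
    show "((\<lambda>x. B (x, \<tau>)) has_vector_derivative B' (x, \<tau>) (1, 0)) (at x within UNIV)"
      using has_vector_derivative_fst_slice[OF B] \<tau> t by auto
  next
    fix x
    have "isCont (\<lambda>t. B (x, t)) \<tau>" if "\<tau> \<in> cbox c t" for \<tau>
      by (rule has_vector_derivative_continuous[OF has_vector_derivative_snd_slice[OF B]]) (use that t in auto)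
    thus "(\<lambda>\<tau>. B (x, \<tau>)) integrable_on cbox c t"
      by (intro integrable_continuous continuous_at_imp_continuous_on) auto
  next
    show "continuous_on (UNIV \<times> cbox c t) (\<lambda>(x, \<tau>). B' (x, \<tau>) (1, 0))"
      using t by (intro continuous_on_subset[OF cont, THEN continuous_on_cong[THEN iffD1, rotated 2]]) auto
  qed auto
  thus ?thesis by simp
qed

lemma C2_mixed_partials_commute:
  fixes f :: "real \<times> real \<Rightarrow> 'b::euclidean_space"
  assumes f1: "\<And>x. (f has_derivative f1 x) (at x)"
    and f2: "\<And>x h. ((\<lambda>x. f1 x h) has_derivative (\<lambda>k. f2 x k h)) (at x)"
    and cont: "\<And>k h. continuous_on UNIV (\<lambda>x. f2 x k h)"
  shows "f2 x (0, 1) (1, 0) = f2 x (1, 0) (0, 1)"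
proof -
  obtain s t where x: "x = (s, t)" by (cases x)
  define c where "c = t - 1"
  have contB: "continuous_on S (\<lambda>\<tau>. f2 (s, \<tau>) (1, 0) (0, 1))" for s S
    by (rule continuous_on_compose2[OF cont]) (auto intro!: continuous_intros)
  have eq: "f1 (s, \<tau>) (1, 0) = f1 (s, c) (1, 0) + integral {c..\<tau>} (\<lambda>\<tau>. f2 (s, \<tau>) (1, 0) (0, 1))"
    if \<tau>: "\<tau> \<in> {c..t+1}" for \<tau>
  proof -
    have F: "f (s, \<tau>) = f (s, c) + integral {c..\<tau>} (\<lambda>\<tau>. f1 (s, \<tau>) (0, 1))" for s
    proof -
      have "((\<lambda>\<tau>. f1 (s, \<tau>) (0, 1)) has_integral (f (s, \<tau>) - f (s, c))) {c..\<tau>}"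
        using \<tau> by (intro fundamental_theorem_of_calculus
             has_vector_derivative_at_within[OF has_vector_derivative_snd_slice[OF f1]]) auto
      thus ?thesis by (simp add: integral_unique)
    qed
    have "((\<lambda>s. f (s, c) + integral {c..\<tau>} (\<lambda>\<tau>. f1 (s, \<tau>) (0, 1))) has_vector_derivative
       f1 (s, c) (1, 0) + integral {c..\<tau>} (\<lambda>\<tau>. f2 (s, \<tau>) (1, 0) (0, 1))) (at s)"
      by (intro has_vector_derivative_add has_vector_derivative_fst_slice[OF f1]
            has_vector_derivative_integral_parameter[where d="t+1"
            and B="\<lambda>x. f1 x (0,1)" and B'="\<lambda>x k. f2 x k (0,1)"])
         (use f2 \<tau> in \<open>auto intro: continuous_on_subset[OF cont]\<close>)
    moreover have "((\<lambda>s. f (s, \<tau>)) has_vector_derivative f1 (s, \<tau>) (1, 0)) (at s)"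
      by (rule has_vector_derivative_fst_slice[OF f1])
    ultimately show ?thesis unfolding F[symmetric] by (rule vector_derivative_unique_at[rotated])
  qed
  have t: "t \<in> {c..t+1}" by (simp add: c_def)
  have "((\<lambda>\<tau>. f1 (s, c) (1, 0) + integral {c..\<tau>} (\<lambda>\<tau>. f2 (s, \<tau>) (1, 0) (0, 1)))
     has_vector_derivative 0 + f2 (s, t) (1, 0) (0, 1)) (at t within {c..t+1})"
    by (intro has_vector_derivative_add has_vector_derivative_const
        integral_has_vector_derivative[OF contB t])
  from has_vector_derivative_transform[OF t eq this]
  have 1: "((\<lambda>\<tau>. f1 (s, \<tau>) (1, 0)) has_vector_derivative f2 (s, t) (1, 0) (0, 1)) (at t within cbox c (t+1))"
    by simp
  have "((\<lambda>\<tau>. f1 (s, \<tau>) (1, 0)) has_vector_derivative f2 (s, t) (0, 1) (1, 0)) (at t within cbox c (t+1))"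
    by (rule has_vector_derivative_at_within[OF has_vector_derivative_snd_slice[OF f2]])
  thus ?thesis unfolding x
    using vector_derivative_unique_within_closed_interval[of c "t + 1" t, OF _ _ _ 1] by (simp add: c_def)
qed

lemma potential_on_strip:
  fixes g1 g2 :: "real \<times> real \<Rightarrow> real"
  assumes g1: "\<And>x. x \<in> strip \<Longrightarrow> (g1 has_derivative D1 x) (at x)"
    and g2: "\<And>x. x \<in> strip \<Longrightarrow> (g2 has_derivative D2 x) (at x)"
    and closed: "\<And>x. x \<in> strip \<Longrightarrow> D2 x (1, 0) = D1 x (0, 1)"
    and cont: "continuous_on strip (\<lambda>x. D2 x (1, 0))"
    and bdy: "\<And>s. g1 (s, 0) = 0"
    and x: "x \<in> strip"
  shows "((\<lambda>x. integral {0..snd x} (\<lambda>\<tau>. g2 (fst x, \<tau>))) has_derivative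
          (\<lambda>h. (g1 x, g2 x) \<bullet> h)) (at x within strip)"
proof -
  have contg2: "continuous_on strip g2"
    using g2 has_derivative_continuous by (blast intro: continuous_at_imp_continuous_on)
  obtain s t where st: "x = (s, t)" "t \<in> {0..1}" using x by (cases x) (auto simp: strip_def)
  have "((\<lambda>\<tau>. D2 (s, \<tau>) (1, 0)) has_integral (g1 (s, t) - g1 (s, 0))) {0..t}"
  proof (rule fundamental_theorem_of_calculus)
    fix \<tau> assume \<tau>: "\<tau> \<in> {0..t}"
    hence S: "(s, \<tau>) \<in> strip" using st by (auto simp: strip_def)
    show "((\<lambda>\<tau>. g1 (s, \<tau>)) has_vector_derivative D2 (s, \<tau>) (1, 0)) (at \<tau> within {0..t})"
      unfolding closed[OF S] by (rule has_vector_derivative_at_within[OF has_vector_derivative_snd_slice[OF g1[OF S]]])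
  qed (use st in auto)
  hence int: "integral {0..t} (\<lambda>\<tau>. D2 (s, \<tau>) (1, 0)) = g1 (s, t)" using bdy by (simp add: integral_unique)
  have fx: "((\<lambda>s. integral {0..t} (\<lambda>\<tau>. g2 (s, \<tau>))) has_derivative (\<lambda>h. h *\<^sub>R g1 (s, t))) (at s)"
    using has_vector_derivative_integral_parameter[of 0 1 g2 D2 t s] g2 cont st(2)
    unfolding int by (auto simp: strip_def has_vector_derivative_def)
  have fy: "((\<lambda>t. integral {0..t} (\<lambda>\<tau>. g2 (s, \<tau>))) has_derivative
     blinfun_apply (blinfun_scaleR_left (g2 (s, t)))) (at t within {0..1})" if "t \<in> {0..1}" for s t
  proof -
    have "continuous_on {0..1} (\<lambda>\<tau>. g2 (s, \<tau>))"
      by (rule continuous_on_compose2[OF contg2]) (auto simp: strip_def intro!: continuous_intros)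
    from integral_has_vector_derivative[OF this that]
    show ?thesis by (simp add: has_vector_derivative_eq_has_derivative_blinfun)
  qed
  have "((\<lambda>(s, t). integral {0..t} (\<lambda>\<tau>. g2 (s, \<tau>))) has_derivative
     (\<lambda>(h, k). h *\<^sub>R g1 (s, t) + blinfun_apply (blinfun_scaleR_left (g2 (s, t))) k)) (at (s, t) within UNIV \<times> {0..1})"
  proof (rule has_derivative_partialsI[OF fx fy])
    have "continuous_on (UNIV \<times> {0..1}) (\<lambda>x. blinfun_scaleR_left (g2 x))"
      using contg2 unfolding strip_def
      by (intro bounded_linear.continuous_on[OF bounded_linear_blinfun_scaleR_left])
    moreover have "(\<lambda>(x, y). blinfun_scaleR_left (g2 (x, y))) = (\<lambda>x. blinfun_scaleR_left (g2 x))" by auto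
    ultimately show "continuous (at (s, t) within UNIV \<times> {0..1}) (\<lambda>(x, y). blinfun_scaleR_left (g2 (x, y)))"
      using st(2) by (simp only: continuous_on_eq_continuous_within) auto
  qed (use st in auto)
  moreover have "(\<lambda>(s, t). integral {0..t} (\<lambda>\<tau>. g2 (s, \<tau>))) = (\<lambda>x. integral {0..snd x} (\<lambda>\<tau>. g2 (fst x, \<tau>)))"
    by (simp add: fun_eq_iff)
  moreover have "(\<lambda>(h, k). h *\<^sub>R g1 (s, t) + blinfun_apply (blinfun_scaleR_left (g2 (s, t))) k) = (\<lambda>h. (g1 x, g2 x) \<bullet> h)"
    by (simp add: fun_eq_iff st algebra_simps)
  ultimately show ?thesis by (simp add: st strip_def)
qed

section \<open>The stream function\<close>

lemma smooth_frechet_derivatives: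
  fixes f :: "'a::euclidean_space \<Rightarrow> 'b::real_normed_vector"
  assumes "smooth f"
  shows "\<And>x. (f has_derivative frechet_derivative f (at x)) (at x)"
    and "\<And>x h. ((\<lambda>x. frechet_derivative f (at x) h) has_derivative
           frechet_derivative (\<lambda>x. frechet_derivative f (at x) h) (at x)) (at x)"
    and "\<And>h. continuous_on UNIV (\<lambda>x. frechet_derivative f (at x) h)"
    and "\<And>k h. continuous_on UNIV (\<lambda>x. frechet_derivative (\<lambda>x. frechet_derivative f (at x) h) (at x) k)"
proof -
  obtain f1 f2 where f: "\<And>x. (f has_derivative f1 x) (at x)"
    "\<And>x h. ((\<lambda>x. f1 x h) has_derivative (\<lambda>k. f2 x k h)) (at x)"
    "\<And>h. continuous_on UNIV (\<lambda>x. f1 x h)" "\<And>k h. continuous_on UNIV (\<lambda>x. f2 x k h)"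
    using smooth_C2[OF assms] by metis
  have 1: "frechet_derivative f (at x) = f1 x" for x using frechet_derivative_at[OF f(1)] by simp
  have 2: "frechet_derivative (\<lambda>x. f1 x h) (at x) = (\<lambda>k. f2 x k h)" for x h
    using frechet_derivative_at[OF f(2)] by simp
  show "\<And>x. (f has_derivative frechet_derivative f (at x)) (at x)"
    "\<And>x h. ((\<lambda>x. frechet_derivative f (at x) h) has_derivative
           frechet_derivative (\<lambda>x. frechet_derivative f (at x) h) (at x)) (at x)"
    "\<And>h. continuous_on UNIV (\<lambda>x. frechet_derivative f (at x) h)"
    "\<And>k h. continuous_on UNIV (\<lambda>x. frechet_derivative (\<lambda>x. frechet_derivative f (at x) h) (at x) k)"
    unfolding 1 2 using f by auto
qed

lemma divergence_identity:
  fixes E M G W X1 X2 :: real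
  assumes div: "G * ps - M * (pt + qs) + E * qt = 0" and W: "W\<^sup>2 = E * G - M\<^sup>2" "W > 0"
    and P: "P = X1 * E + X2 * M" and Q: "Q = X1 * M + X2 * G"
    and ds: "Es = 2 * u1" "Ms = v1 + u2" "Gs = 2 * v2" "Ps = ps + (X1 * u1 + X2 * v1)" "Qs = qs + (X1 * u2 + X2 * v2)"
      "Ws = (Es * G + E * Gs - 2 * M * Ms) / (2 * W)"
    and dt: "Et = 2 * u2" "Mt = v2 + u3" "Gt = 2 * v3" "Pt = pt + (X1 * u2 + X2 * v2)" "Qt = qt + (X1 * u3 + X2 * v3)"
      "Wt = (Et * G + E * Gt - 2 * M * Mt) / (2 * W)"
  shows "((Gs * P + G * Ps - (Ms * Q + M * Qs)) * W - (G * P - M * Q) * Ws) / (W * W)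
       = ((Mt * P + M * Pt - (Et * Q + E * Qt)) * W - (M * P - E * Q) * Wt) / (W * W)"
proof -
  define B where "B = X1 * (Es * G + E * Gs - 2 * M * Ms) / 2"
  define B' where "B' = - X2 * (Et * G + E * Gt - 2 * M * Mt) / 2"
  have eq: "G * P - M * Q = X1 * W\<^sup>2" "M * P - E * Q = - X2 * W\<^sup>2"
    unfolding P Q W by (simp_all add: algebra_simps power2_eq_square)
  have "c * W\<^sup>2 * (D / (2 * W)) = c * D / 2 * W" for c D
    using W(2) by (simp add: power2_eq_square)
  hence 1: "(G * P - M * Q) * Ws = B * W" "(M * P - E * Q) * Wt = B' * W"
    unfolding ds(6) dt(6) eq B_def B'_def by simp_all
  have "(Gs * P + G * Ps - (Ms * Q + M * Qs) - B) - (Mt * P + M * Pt - (Et * Q + E * Qt) - B')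
     = G * ps - M * (pt + qs) + E * qt"
    unfolding P Q ds dt B_def B'_def by (simp add: field_simps)
  hence "Gs * P + G * Ps - (Ms * Q + M * Qs) - B = Mt * P + M * Pt - (Et * Q + E * Qt) - B'"
    using div by simp
  thus ?thesis unfolding 1 left_diff_distrib[symmetric] by (rule arg_cong)
qed

locale annulus_field =
  fixes F :: "real \<times> real \<Rightarrow> R3" and j :: "R3 \<Rightarrow> R3"
  assumes param: "annulus_param F"
    and smooth_field: "smooth j"
    and tangent: "tangent_field F j"
    and divergence_free: "\<forall>x\<in>strip. surf_div F j x = 0"
begin

definition DF where "DF x = frechet_derivative F (at x)"
definition Dj where "Dj p = frechet_derivative j (at p)"
definition dFs where "dFs x = frechet_derivative (Fs F) (at x)"
definition dFt where "dFt x = frechet_derivative (Ft F) (at x)"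

definition E where "E x = Fs F x \<bullet> Fs F x"
definition M where "M x = Fs F x \<bullet> Ft F x"
definition G where "G x = Ft F x \<bullet> Ft F x"
definition P where "P x = j (F x) \<bullet> Fs F x"
definition Q where "Q x = j (F x) \<bullet> Ft F x"
definition W where "W x = sqrt (E x * G x - (M x)\<^sup>2)"

text \<open>For \<open>j \<circ> F = X\<^sub>1 F\<^sub>s + X\<^sub>2 F\<^sub>t\<close> on the strip, \<open>(g1, g2) = W (- X\<^sub>2, X\<^sub>1)\<close> is the gradient of the stream function.\<close>
definition g1 where "g1 x = (M x * P x - E x * Q x) / W x"
definition g2 where "g2 x = (G x * P x - M x * Q x) / W x"

lemma smooth_F: "smooth F" using param by (simp add: annulus_param_def)

lemma F_deriv: "(F has_derivative DF x) (at x)"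
  unfolding DF_def by (rule smooth_frechet_derivatives[OF smooth_F])

lemma j_deriv: "(j has_derivative Dj p) (at p)"
  unfolding Dj_def by (rule smooth_frechet_derivatives[OF smooth_field])

lemma Fs_deriv: "(Fs F has_derivative dFs x) (at x)"
  using smooth_frechet_derivatives(2)[OF smooth_F] unfolding dFs_def Fs_def[abs_def] .

lemma Ft_deriv: "(Ft F has_derivative dFt x) (at x)"
  using smooth_frechet_derivatives(2)[OF smooth_F] unfolding dFt_def Ft_def[abs_def] .

lemma J_deriv: "((\<lambda>x. j (F x)) has_derivative (\<lambda>h. Dj (F x) (DF x h))) (at x)"
  using diff_chain_at[OF F_deriv j_deriv] by (simp add: o_def)

lemma linear_DF: "linear (DF x)" using F_deriv has_derivative_linear by blast
lemma linear_Dj: "linear (Dj p)" using j_deriv has_derivative_linear by blast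

lemma DF_eq: "DF x h = fst h *\<^sub>R Fs F x + snd h *\<^sub>R Ft F x"
proof -
  have "DF x h = DF x (fst h *\<^sub>R (1, 0) + snd h *\<^sub>R (0, 1))" by simp
  also have "\<dots> = fst h *\<^sub>R DF x (1, 0) + snd h *\<^sub>R DF x (0, 1)"
    by (simp only: linear_add[OF linear_DF] linear_cmul[OF linear_DF])
  finally show ?thesis by (simp add: DF_def Fs_def Ft_def)
qed

lemma mixed_partials: "dFs x (0, 1) = dFt x (1, 0)"
  using C2_mixed_partials_commute[of F DF "\<lambda>x k h. frechet_derivative (\<lambda>x. frechet_derivative F (at x) h) (at x) k" x]
    smooth_frechet_derivatives[OF smooth_F] unfolding DF_def dFs_def dFt_def Fs_def[abs_def] Ft_def[abs_def] by blast

lemma cont_F: "continuous_on S F"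
  using F_deriv has_derivative_continuous by (blast intro: continuous_at_imp_continuous_on)
lemma cont_j: "continuous_on S j"
  using j_deriv has_derivative_continuous by (blast intro: continuous_at_imp_continuous_on)
lemma cont_Fs: "continuous_on S (Fs F)"
  using Fs_deriv has_derivative_continuous by (blast intro: continuous_at_imp_continuous_on)
lemma cont_Ft: "continuous_on S (Ft F)"
  using Ft_deriv has_derivative_continuous by (blast intro: continuous_at_imp_continuous_on)
lemma cont_dFs: "continuous_on S (\<lambda>x. dFs x h)"
  using smooth_frechet_derivatives(4)[OF smooth_F] unfolding dFs_def Fs_def[abs_def]
  by (rule continuous_on_subset) simp
lemma cont_dFt: "continuous_on S (\<lambda>x. dFt x h)"
  using smooth_frechet_derivatives(4)[OF smooth_F] unfolding dFt_def Ft_def[abs_def]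
  by (rule continuous_on_subset) simp
lemma cont_Dj: "continuous_on S (\<lambda>p. Dj p h)"
  using smooth_frechet_derivatives(3)[OF smooth_field] unfolding Dj_def
  by (rule continuous_on_subset) simp
lemma cont_J: "continuous_on S (\<lambda>x. j (F x))"
  by (rule continuous_on_compose2[OF cont_j cont_F]) auto
lemma cont_DJ: "continuous_on S (\<lambda>x. Dj (F x) (DF x h))"
proof (rule continuous_on_apply_linear[where L="\<lambda>x. Dj (F x)"])
  show "continuous_on S (\<lambda>x. Dj (F x) h)" for h
    by (rule continuous_on_compose2[OF cont_Dj cont_F]) auto
  show "continuous_on S (\<lambda>x. DF x h)"
    unfolding DF_eq by (intro continuous_intros cont_Fs cont_Ft)
qed (rule linear_Dj)

lemma immersion:
  assumes "x \<in> strip" "DF x h = 0"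
  shows "h = 0"
proof (rule ccontr)
  assume "h \<noteq> 0"
  hence "(fst h, snd h) \<noteq> (0, 0)" by (simp add: prod_eq_iff)
  thus False using param assms unfolding annulus_param_def DF_eq by blast
qed

lemma gram_pos:
  assumes x: "x \<in> strip"
  shows "E x * G x - (M x)\<^sup>2 > 0"
proof -
  have b: "Ft F x \<noteq> 0" using immersion[OF x, of "(0,1)"] by (auto simp: DF_eq zero_prod_def)
  hence G: "G x > 0" by (simp add: G_def)
  have "DF x (G x, - M x) \<noteq> 0" using immersion[OF x, of "(G x, - M x)"] G by (auto simp: zero_prod_def)
  hence "0 < DF x (G x, - M x) \<bullet> DF x (G x, - M x)" by simp
  also have "\<dots> = G x * (E x * G x - (M x)\<^sup>2)"
    by (simp add: DF_eq E_def M_def G_def inner_diff_left inner_diff_right power2_eq_square algebra_simps inner_commute)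
  finally show ?thesis using G by (simp add: zero_less_mult_iff)
qed

lemma W_pos: "x \<in> strip \<Longrightarrow> W x > 0" using gram_pos by (simp add: W_def)
lemma W_square: "x \<in> strip \<Longrightarrow> (W x)\<^sup>2 = E x * G x - (M x)\<^sup>2" using gram_pos[of x] by (simp add: W_def)

lemma field_coordinates:
  assumes x: "x \<in> strip"
  obtains X where "j (F x) = DF x X" "g1 x = - W x * snd X" "g2 x = W x * fst X"
proof -
  have "j (F x) \<in> span {Fs F x, Ft F x}" using tangent x by (simp add: tangent_field_def)
  then obtain X1 X2 where X: "j (F x) = X1 *\<^sub>R Fs F x + X2 *\<^sub>R Ft F x"
    by (auto simp: span_insert span_singleton algebra_simps)
  have JX: "j (F x) \<bullet> v = X1 * (Fs F x \<bullet> v) + X2 * (Ft F x \<bullet> v)" for v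
    by (simp add: X inner_add_left)
  hence JX': "v \<bullet> j (F x) = X1 * (Fs F x \<bullet> v) + X2 * (Ft F x \<bullet> v)" for v
    by (simp add: inner_commute)
  have "P x = X1 * E x + X2 * M x" "Q x = X1 * M x + X2 * G x"
    by (simp_all add: P_def Q_def JX E_def M_def G_def inner_commute[of "Ft F x" "Fs F x"])
  hence "M x * P x - E x * Q x = - X2 * (W x)\<^sup>2" "G x * P x - M x * Q x = X1 * (W x)\<^sup>2"
    unfolding W_square[OF x] by (simp_all add: algebra_simps power2_eq_square)
  thus thesis using that[of "(X1, X2)"] W_pos[OF x]
    by (simp add: DF_eq X g1_def g2_def power2_eq_square)
qed

lemma g1_boundary:
  assumes "t \<in> {0, 1}"
  shows "g1 (s, t) = 0"
proof -
  have "j (F (s, t)) \<in> span {Fs F (s, t)}" using tangent assms by (auto simp: tangent_field_def)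
  then obtain c where "j (F (s, t)) = c *\<^sub>R Fs F (s, t)" by (auto simp: span_singleton)
  thus ?thesis by (simp add: g1_def P_def Q_def M_def E_def)
qed

definition dE where "dE x h = 2 * (Fs F x \<bullet> dFs x h)"
definition dM where "dM x h = Fs F x \<bullet> dFt x h + dFs x h \<bullet> Ft F x"
definition dG where "dG x h = 2 * (Ft F x \<bullet> dFt x h)"
definition dP where "dP x h = j (F x) \<bullet> dFs x h + Dj (F x) (DF x h) \<bullet> Fs F x"
definition dQ where "dQ x h = j (F x) \<bullet> dFt x h + Dj (F x) (DF x h) \<bullet> Ft F x"
definition dW where "dW x h = (dE x h * G x + E x * dG x h - 2 * M x * dM x h) / (2 * W x)"
definition dg1 where
  "dg1 x h = ((dM x h * P x + M x * dP x h - (dE x h * Q x + E x * dQ x h)) * W x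
     - (M x * P x - E x * Q x) * dW x h) / (W x * W x)"
definition dg2 where
  "dg2 x h = ((dG x h * P x + G x * dP x h - (dM x h * Q x + M x * dQ x h)) * W x
     - (G x * P x - M x * Q x) * dW x h) / (W x * W x)"

lemma coefficient_derivs:
  "(E has_derivative dE x) (at x)" "(M has_derivative dM x) (at x)" "(G has_derivative dG x) (at x)"
  "(P has_derivative dP x) (at x)" "(Q has_derivative dQ x) (at x)"
  unfolding E_def[abs_def] M_def[abs_def] G_def[abs_def] P_def[abs_def] Q_def[abs_def]
  by (rule has_derivative_eq_rhs[OF has_derivative_inner[OF Fs_deriv Fs_deriv]],
      simp add: dE_def fun_eq_iff inner_commute,
      rule has_derivative_eq_rhs[OF has_derivative_inner[OF Fs_deriv Ft_deriv]],
      simp add: dM_def fun_eq_iff,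
      rule has_derivative_eq_rhs[OF has_derivative_inner[OF Ft_deriv Ft_deriv]],
      simp add: dG_def fun_eq_iff inner_commute,
      rule has_derivative_eq_rhs[OF has_derivative_inner[OF J_deriv Fs_deriv]],
      simp add: dP_def fun_eq_iff,
      rule has_derivative_eq_rhs[OF has_derivative_inner[OF J_deriv Ft_deriv]],
      simp add: dQ_def fun_eq_iff)

lemma W_deriv:
  assumes x: "x \<in> strip"
  shows "(W has_derivative dW x) (at x)"
proof -
  have "((\<lambda>x. E x * G x - M x * M x) has_derivative
     (\<lambda>h. E x * dG x h + dE x h * G x - (M x * dM x h + dM x h * M x))) (at x)"
    by (intro has_derivative_diff has_derivative_mult coefficient_derivs)
  from has_derivative_real_sqrt[OF _ this] gram_pos[OF x] show ?thesis
    unfolding W_def[abs_def] power2_eq_square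
    by (rule_tac has_derivative_eq_rhs) (auto simp: dW_def W_def fun_eq_iff power2_eq_square field_simps)
qed

lemma g_derivs:
  assumes x: "x \<in> strip"
  shows "(g1 has_derivative dg1 x) (at x)" "(g2 has_derivative dg2 x) (at x)"
proof -
  note c = coefficient_derivs[of x] W_deriv[OF x]
  have W: "W x \<noteq> 0" using W_pos[OF x] by simp
  have "((\<lambda>x. M x * P x - E x * Q x) has_derivative
     (\<lambda>h. M x * dP x h + dM x h * P x - (E x * dQ x h + dE x h * Q x))) (at x)"
    by (intro has_derivative_diff has_derivative_mult c)
  from has_derivative_divide'[OF this c(6) W]
  show "(g1 has_derivative dg1 x) (at x)"
    unfolding g1_def[abs_def] by (rule has_derivative_eq_rhs) (simp add: dg1_def fun_eq_iff add.commute)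
  have "((\<lambda>x. G x * P x - M x * Q x) has_derivative
     (\<lambda>h. G x * dP x h + dG x h * P x - (M x * dQ x h + dM x h * Q x))) (at x)"
    by (intro has_derivative_diff has_derivative_mult c)
  from has_derivative_divide'[OF this c(6) W]
  show "(g2 has_derivative dg2 x) (at x)"
    unfolding g2_def[abs_def] by (rule has_derivative_eq_rhs) (simp add: dg2_def fun_eq_iff add.commute)
qed

lemma cont_dg: "continuous_on strip (\<lambda>x. dg1 x h)" "continuous_on strip (\<lambda>x. dg2 x h)"
proof -
  note i = cont_Fs cont_Ft cont_J cont_DJ cont_dFs cont_dFt
  have W: "continuous_on strip W"
    using W_deriv has_derivative_continuous by (blast intro: continuous_at_imp_continuous_on)
  have W0: "W x \<noteq> 0" if "x \<in> strip" for x using W_pos[OF that] by simp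
  have 1: "continuous_on strip E" "continuous_on strip M" "continuous_on strip G"
    "continuous_on strip P" "continuous_on strip Q"
    unfolding E_def[abs_def] M_def[abs_def] G_def[abs_def] P_def[abs_def] Q_def[abs_def]
    by (intro continuous_intros i)+
  have 2: "continuous_on strip (\<lambda>x. dE x h)" "continuous_on strip (\<lambda>x. dM x h)" "continuous_on strip (\<lambda>x. dG x h)"
    "continuous_on strip (\<lambda>x. dP x h)" "continuous_on strip (\<lambda>x. dQ x h)"
    unfolding dE_def dM_def dG_def dP_def dQ_def by (intro continuous_intros i)+
  have 3: "continuous_on strip (\<lambda>x. dW x h)"
    unfolding dW_def by (intro continuous_intros 1 2 W) (use W0 in auto)
  show "continuous_on strip (\<lambda>x. dg1 x h)" "continuous_on strip (\<lambda>x. dg2 x h)"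
    unfolding dg1_def dg2_def by (intro continuous_intros 1 2 3 W; use W0 in auto)+
qed

lemma g_closed:
  assumes x: "x \<in> strip"
  shows "dg2 x (1, 0) = dg1 x (0, 1)"
proof -
  have "j (F x) \<in> span {Fs F x, Ft F x}" using tangent x by (simp add: tangent_field_def)
  then obtain X1 X2 where X: "j (F x) = X1 *\<^sub>R Fs F x + X2 *\<^sub>R Ft F x"
    by (auto simp: span_insert span_singleton algebra_simps)
  have JX: "j (F x) \<bullet> v = X1 * (Fs F x \<bullet> v) + X2 * (Ft F x \<bullet> v)" for v
    by (simp add: X inner_add_left)
  hence JX': "v \<bullet> j (F x) = X1 * (Fs F x \<bullet> v) + X2 * (Ft F x \<bullet> v)" for v
    by (simp add: inner_commute)
  have DF: "DF x (1, 0) = Fs F x" "DF x (0, 1) = Ft F x" by (simp_all add: DF_eq)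
  have "surf_div F j x = 0" using divergence_free x by blast
  hence "(G x * (Fs F x \<bullet> Dj (F x) (Fs F x)) - M x * (Fs F x \<bullet> Dj (F x) (Ft F x) + Ft F x \<bullet> Dj (F x) (Fs F x))
     + E x * (Ft F x \<bullet> Dj (F x) (Ft F x))) / (E x * G x - (M x)\<^sup>2) = 0"
    by (simp add: surf_div_def Let_def E_def M_def G_def Dj_def)
  hence "G x * (Fs F x \<bullet> Dj (F x) (Fs F x)) - M x * (Fs F x \<bullet> Dj (F x) (Ft F x) + Ft F x \<bullet> Dj (F x) (Fs F x))
     + E x * (Ft F x \<bullet> Dj (F x) (Ft F x)) = 0"
    using gram_pos[OF x] by (metis divide_eq_0_iff less_irrefl)
  from divergence_identity[OF this W_square[OF x] W_pos[OF x], of "P x" X1 X2 "Q x"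
     "dE x (1,0)" "Fs F x \<bullet> dFs x (1,0)" "dM x (1,0)" "Ft F x \<bullet> dFs x (1,0)" "Fs F x \<bullet> dFt x (1,0)"
     "dG x (1,0)" "Ft F x \<bullet> dFt x (1,0)" "dP x (1,0)" "dQ x (1,0)" "dW x (1,0)"
     "dE x (0,1)" "dM x (0,1)" "Fs F x \<bullet> dFt x (0,1)" "dG x (0,1)" "Ft F x \<bullet> dFt x (0,1)"
     "dP x (0,1)" "dQ x (0,1)" "dW x (0,1)"]
  show ?thesis unfolding dg1_def dg2_def
    by (simp add: P_def Q_def E_def M_def G_def dE_def dM_def dG_def dP_def dQ_def dW_def JX JX' DF mixed_partials
         inner_commute)
qed

definition g where "g x = (g1 x, g2 x)"
definition psi where "psi x = integral {0..snd x} (\<lambda>\<tau>. g2 (fst x, \<tau>))"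

lemma psi_deriv:
  assumes "x \<in> strip"
  shows "(psi has_derivative (\<lambda>h. g x \<bullet> h)) (at x within strip)"
  using potential_on_strip[OF g_derivs(1) g_derivs(2) g_closed cont_dg(2) g1_boundary assms]
  by (simp add: psi_def[abs_def] g_def)

lemma cont_psi: "continuous_on strip psi"
  unfolding continuous_on_eq_continuous_within using has_derivative_continuous[OF psi_deriv] by blast

lemma g_deriv: "x \<in> strip \<Longrightarrow> (g has_derivative (\<lambda>h. (dg1 x h, dg2 x h))) (at x)"
  unfolding g_def[abs_def] by (intro has_derivative_Pair g_derivs)

lemma g_coordinates:
  assumes x: "x \<in> strip"
  obtains X w where "j (F x) = DF x X" "w > 0" "\<And>h. g x \<bullet> h = w * (fst X * snd h - snd X * fst h)"
    "g x = (- w * snd X, w * fst X)"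
proof -
  obtain X where X: "j (F x) = DF x X" "g1 x = - W x * snd X" "g2 x = W x * fst X"
    using field_coordinates[OF x] .
  show thesis
    by (rule that[of X "W x"]) (use X W_pos[OF x] in \<open>auto simp: g_def inner_prod_def algebra_simps\<close>)
qed

end

section \<open>Level sets on the surface\<close>

lemma continuous_on_descend:
  fixes f :: "'a::topological_space \<Rightarrow> 'b::t2_space"
  assumes "compact K" "continuous_on K f" "continuous_on K h" and eq: "\<And>x. x \<in> K \<Longrightarrow> h' (f x) = h x"
  shows "continuous_on (f ` K) h'"
proof -
  have cl: "closed (f ` K)" using assms by (intro compact_imp_closed compact_continuous_image)
  show ?thesis
    unfolding continuous_on_closed_vimage[OF cl]
  proof (intro allI impI)
    fix B :: "'c set" assume "closed B"
    obtain A where A: "closed A" "A \<inter> K = h -` B \<inter> K"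
      using continuous_on_closed_invariant[THEN iffD1, OF assms(3)] \<open>closed B\<close> by blast
    have "compact (A \<inter> K)" using A(1) \<open>compact K\<close> by (rule closed_Int_compact)
    hence "compact (f ` (A \<inter> K))"
      using assms by (intro compact_continuous_image) (auto intro: continuous_on_subset)
    moreover have "h' -` B \<inter> f ` K = f ` (A \<inter> K)" unfolding A(2) using eq by auto
    ultimately show "closed (h' -` B \<inter> f ` K)" by (metis compact_imp_closed)
  qed
qed

lemma has_derivative_linear_approx:
  assumes "(f has_derivative f') (at x within S)" "e > 0"
  obtains d where "d > 0"
    "\<And>y. y \<in> S \<Longrightarrow> norm (y - x) < d \<Longrightarrow> norm (f y - f x - f' (y - x)) \<le> e * norm (y - x)"
  using assms unfolding has_derivative_within_alt by blast

lemma injective_derivative_expanding: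
  fixes f :: "'a::euclidean_space \<Rightarrow> 'b::euclidean_space"
  assumes f: "(f has_derivative f') (at x within S)" and inj: "\<And>h. f' h = 0 \<Longrightarrow> h = 0"
  obtains \<kappa> d where "\<kappa> > 0" "d > 0"
    "\<And>y. y \<in> S \<Longrightarrow> norm (y - x) < d \<Longrightarrow> \<kappa> * norm (y - x) \<le> norm (f y - f x)"
proof -
  have lin: "linear f'" using f has_derivative_linear by blast
  obtain B where B: "B > 0" "\<And>h. B * norm h \<le> norm (f' h)"
    using linear_inj_bounded_below_pos[OF lin] inj linear_injective_0[OF lin] by blast
  obtain d where d: "d > 0" "\<And>y. y \<in> S \<Longrightarrow> norm (y - x) < d \<Longrightarrow> norm (f y - f x - f' (y - x)) \<le> (B/2) * norm (y - x)"
    using has_derivative_linear_approx[OF f half_gt_zero[OF B(1)]] by blast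
  show thesis
  proof (rule that[of "B/2" d])
    fix y assume y: "y \<in> S" "norm (y - x) < d"
    have "B * norm (y - x) \<le> norm (f y - f x) + norm (f y - f x - f' (y - x))"
      using B(2)[of "y - x"] norm_triangle_ineq4[of "f y - f x" "f y - f x - f' (y - x)"] by simp
    thus "B/2 * norm (y - x) \<le> norm (f y - f x)" using d(2)[OF y] by simp
  qed (use B d in auto)
qed

context annulus_field
begin

lemma F_shift_int: "F (s + of_int n, t) = F (s, t)"
proof -
  have nat: "F (s + real m, t) = F (s, t)" for s m
  proof (induction m)
    case (Suc m)
    have "F (s + real (Suc m), t) = F ((s + real m) + 1, t)" by (simp add: add_ac)
    also have "\<dots> = F (s + real m, t)" using param unfolding annulus_param_def by blast
    finally show ?case using Suc by simp
  qed simp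
  show ?thesis
  proof (cases "n \<ge> 0")
    case True thus ?thesis using nat[of s "nat n"] by simp
  next
    case False thus ?thesis using nat[of "s + of_int n" "nat (- n)"] by simp
  qed
qed

lemma F_eq_iff:
  assumes x: "x \<in> strip" and y: "y \<in> strip"
  shows "F x = F y \<longleftrightarrow> (\<exists>n::int. y = x + (of_int n, 0))"
proof
  assume eq: "F x = F y"
  have fr: "F (frac (fst z), snd z) = F z" for z
    using F_shift_int[of "frac (fst z)" "\<lfloor>fst z\<rfloor>" "snd z"] by (simp add: frac_def)
  have fund: "(frac (fst z), snd z) \<in> {0..<1} \<times> {0..1}" if "z \<in> strip" for z
    using that by (auto simp: strip_def frac_lt_1)
  have "(frac (fst x), snd x) = (frac (fst y), snd y)"
    using param fund[OF x] fund[OF y] eq fr unfolding annulus_param_def inj_on_def by metis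
  hence "y = x + (of_int (\<lfloor>fst y\<rfloor> - \<lfloor>fst x\<rfloor>), 0)"
    by (cases x; cases y) (auto simp: frac_def)
  thus "\<exists>n::int. y = x + (of_int n, 0)" by blast
next
  assume "\<exists>n::int. y = x + (of_int n, 0)"
  thus "F x = F y" using F_shift_int by (cases x) auto
qed

lemma DF_shift_int: "DF (x + (of_int n, 0)) = DF x"
proof -
  let ?v = "(of_int n, 0) :: real \<times> real"
  have "((\<lambda>y. y + ?v) has_derivative (\<lambda>h. h)) (at x)" by (auto intro!: derivative_eq_intros)
  from diff_chain_at[OF this F_deriv[of "x + ?v"]]
  have "((\<lambda>y. F (y + ?v)) has_derivative DF (x + ?v)) (at x)" by (simp add: o_def)
  moreover have "(\<lambda>y. F (y + ?v)) = F" using F_shift_int by (auto simp: fun_eq_iff)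
  ultimately show ?thesis using F_deriv has_derivative_unique by metis
qed

lemma psi_shift_int: "psi (x + (of_int n, 0)) = psi x"
proof -
  have "F (y + (of_int n, 0)) = F y" for y using F_shift_int by (cases y) simp
  moreover have "Fs F (y + (of_int n, 0)) = Fs F y" "Ft F (y + (of_int n, 0)) = Ft F y" for y
    using DF_shift_int[of y n] unfolding DF_def Fs_def Ft_def by simp_all
  ultimately have "g2 (y + (of_int n, 0)) = g2 y" for y
    unfolding g2_def W_def E_def M_def G_def P_def Q_def by simp
  hence "g2 (fst x + of_int n, \<tau>) = g2 (fst x, \<tau>)" for \<tau>
    by (metis add.right_neutral add_Pair)
  thus ?thesis by (simp add: psi_def)
qed

definition psiS where "psiS p = psi (SOME x. x \<in> strip \<and> F x = p)"

lemma psiS_F: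
  assumes "x \<in> strip"
  shows "psiS (F x) = psi x"
proof -
  have "(SOME y. y \<in> strip \<and> F y = F x) \<in> strip \<and> F (SOME y. y \<in> strip \<and> F y = F x) = F x"
    by (rule someI[of _ x]) (use assms in simp)
  thus ?thesis unfolding psiS_def using F_eq_iff assms psi_shift_int by metis
qed

lemma surf_lift_near:
  assumes "p \<in> surf F"
  obtains x where "x \<in> {s0 - 1/2..s0 + 1/2} \<times> {0..1}" "F x = p"
proof -
  obtain s t where st: "p = F (s, t)" "t \<in> {0..1}" using assms by (auto simp: surf_def strip_def)
  define n where "n = - \<lfloor>s - s0 + 1/2\<rfloor>"
  have "s + of_int n \<in> {s0 - 1/2..s0 + 1/2}" unfolding n_def by (simp, linarith)
  thus thesis using that[of "(s + of_int n, t)"] st F_shift_int by simp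
qed

lemma surf_eq: "surf F = F ` ({s0 - 1/2..s0 + 1/2} \<times> {0..1})"
proof
  show "surf F \<subseteq> F ` ({s0 - 1/2..s0 + 1/2} \<times> {0..1})"
    using surf_lift_near[of _ s0] by (metis image_eqI subsetI)
qed (auto simp: surf_def strip_def)

lemma compact_surf: "compact (surf F)"
  unfolding surf_eq[of 0] by (intro compact_continuous_image cont_F compact_Times compact_Icc)

lemma continuous_on_surf:
  assumes h: "continuous_on strip h" and eq: "\<And>x. x \<in> strip \<Longrightarrow> h' (F x) = h x"
  shows "continuous_on (surf F) h'"
  unfolding surf_eq[of 0]
proof (rule continuous_on_descend)
  show "compact ({0 - 1/2..0 + 1/2::real} \<times> {0..1::real})" by (intro compact_Times compact_Icc)
  show "continuous_on ({0 - 1/2..0 + 1/2} \<times> {0..1}) h"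
    by (rule continuous_on_subset[OF h]) (auto simp: strip_def)
qed (use eq in \<open>auto simp: strip_def intro: cont_F\<close>)

lemma cont_psiS: "continuous_on (surf F) psiS"
  using continuous_on_surf[OF cont_psi] psiS_F by blast

lemma local_lift:
  assumes x0: "x0 \<in> strip" and e: "e > 0"
  obtains d where "d > 0"
    "\<And>p. p \<in> surf F \<Longrightarrow> norm (p - F x0) < d \<Longrightarrow> \<exists>x\<in>strip. F x = p \<and> norm (x - x0) < e"
proof -
  define K where "K = {fst x0 - 1/2..fst x0 + 1/2} \<times> {0..1} - ball x0 e"
  have "compact K" unfolding K_def by (intro compact_diff compact_Times compact_Icc open_ball)
  hence cl: "closed (F ` K)" by (intro compact_imp_closed compact_continuous_image cont_F)
  have nK: "F x0 \<notin> F ` K"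
  proof
    assume "F x0 \<in> F ` K"
    then obtain x where x: "x \<in> K" "F x0 = F x" by blast
    hence "x \<in> strip" by (auto simp: K_def strip_def)
    then obtain n :: int where n: "x = x0 + (of_int n, 0)" using x x0 F_eq_iff by blast
    hence "fst x = fst x0 + of_int n" by simp
    hence "\<bar>real_of_int n\<bar> \<le> 1/2" using x(1) by (auto simp: K_def)
    hence "n = 0" by linarith
    hence "x = x0" using n by (simp add: prod_eq_iff)
    thus False using x(1) e by (simp add: K_def)
  qed
  obtain d where d: "d > 0" "\<And>q. q \<in> F ` K \<Longrightarrow> d \<le> dist (F x0) q"
    using separate_point_closed[OF cl nK] by meson
  show thesis
  proof (rule that[OF d(1)])
    fix p assume p: "p \<in> surf F" "norm (p - F x0) < d"
    obtain x where x: "x \<in> {fst x0 - 1/2..fst x0 + 1/2} \<times> {0..1}" "F x = p"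
      using surf_lift_near[OF p(1)] .
    have "x \<notin> K" using d(2)[of p] p(2) x(2) by (auto simp: dist_norm norm_minus_commute)
    hence "norm (x - x0) < e" using x(1) by (auto simp: K_def dist_norm norm_minus_commute)
    moreover have "x \<in> strip" using x(1) by (auto simp: strip_def)
    ultimately show "\<exists>x\<in>strip. F x = p \<and> norm (x - x0) < e" using x(2) by blast
  qed
qed

lemma psiS_deriv:
  assumes q: "q \<in> surf F"
  obtains l where "(psiS has_derivative l) (at q within surf F)" "l (j q) = 0"
proof -
  obtain x0 where x0: "x0 \<in> strip" "q = F x0" using q by (auto simp: surf_def)
  have imm: "\<And>h. DF x0 h = 0 \<Longrightarrow> h = 0" using immersion[OF x0(1)] .
  obtain L where L: "linear L" "L \<circ> DF x0 = id"
    using linear_injective_left_inverse[OF linear_DF[of x0]] imm linear_injective_0[OF linear_DF] by blast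
  define l where "l v = g x0 \<bullet> L v" for v
  have linl: "linear l" unfolding l_def
    by (rule linearI) (simp_all add: linear_add[OF L(1)] linear_cmul[OF L(1)] inner_add_right)
  have lDF: "l (DF x0 h) = g x0 \<bullet> h" for h using fun_cong[OF L(2), of h] by (simp add: l_def)
  obtain C where C: "C > 0" "\<And>v. norm (l v) \<le> C * norm v" using linear_bounded_pos[OF linl] by blast
  obtain \<kappa> d1 where \<kappa>: "\<kappa> > 0" "d1 > 0"
    "\<And>y. norm (y - x0) < d1 \<Longrightarrow> \<kappa> * norm (y - x0) \<le> norm (F y - F x0)"
    using injective_derivative_expanding[OF F_deriv imm] by (metis UNIV_I)
  show thesis
  proof (rule that[of l])
    show "(psiS has_derivative l) (at q within surf F)"
      unfolding has_derivative_within_alt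
    proof (intro conjI allI impI)
      show "bounded_linear l" using linl by (simp add: linear_conv_bounded_linear)
      fix e :: real assume e: "e > 0"
      have e1: "e * \<kappa> / 2 > 0" and e2: "e * \<kappa> / (2 * C) > 0" using e \<kappa> C by auto
      obtain d2 where d2: "d2 > 0" "\<And>y. y \<in> strip \<Longrightarrow> norm (y - x0) < d2 \<Longrightarrow>
            norm (psi y - psi x0 - g x0 \<bullet> (y - x0)) \<le> e * \<kappa> / 2 * norm (y - x0)"
        using has_derivative_linear_approx[OF psi_deriv[OF x0(1)] e1] by blast
      obtain d3 where d3: "d3 > 0" "\<And>y. norm (y - x0) < d3 \<Longrightarrow>
            norm (F y - F x0 - DF x0 (y - x0)) \<le> e * \<kappa> / (2 * C) * norm (y - x0)"
        using has_derivative_linear_approx[OF F_deriv[of x0] e2] by auto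
      define m where "m = min d1 (min d2 d3)"
      have m: "m > 0" using d2 d3 \<kappa> by (simp add: m_def)
      obtain d where d: "d > 0" "\<And>p. p \<in> surf F \<Longrightarrow> norm (p - F x0) < d \<Longrightarrow> \<exists>x\<in>strip. F x = p \<and> norm (x - x0) < m"
        using local_lift[OF x0(1) m] by blast
      have "norm (psiS p - psiS q - l (p - q)) \<le> e * norm (p - q)"
        if p: "p \<in> surf F" "norm (p - q) < d" for p
      proof -
        obtain x where x: "x \<in> strip" "F x = p" "norm (x - x0) < m" using d(2) p x0 by blast
        have 1: "norm (psi x - psi x0 - g x0 \<bullet> (x - x0)) \<le> e * \<kappa> / 2 * norm (x - x0)"
          using d2(2)[OF x(1)] x(3) by (simp add: m_def)
        have "norm (F x - F x0 - DF x0 (x - x0)) \<le> e * \<kappa> / (2 * C) * norm (x - x0)"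
          using d3(2) x(3) by (simp add: m_def)
        hence "C * norm (F x - F x0 - DF x0 (x - x0)) \<le> e * \<kappa> / 2 * norm (x - x0)"
          using C(1) by (simp add: field_simps)
        hence 2: "norm (l (F x - F x0) - g x0 \<bullet> (x - x0)) \<le> e * \<kappa> / 2 * norm (x - x0)"
          using C(2)[of "F x - F x0 - DF x0 (x - x0)"] by (simp add: linear_diff[OF linl] lDF)
        define c where "c = e * \<kappa> / 2 * norm (x - x0)"
        have "\<bar>psi x - psi x0 - l (F x - F x0)\<bar> \<le> 2 * c"
          using 1 2 unfolding c_def[symmetric] real_norm_def by linarith
        hence "norm (psiS p - psiS q - l (p - q)) \<le> e * (\<kappa> * norm (x - x0))"
          unfolding x0(2) x(2)[symmetric] psiS_F[OF x(1)] psiS_F[OF x0(1)] by (simp add: c_def)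
        also have "\<dots> \<le> e * norm (p - q)"
          using \<kappa>(3)[of x] x x0 e by (simp add: m_def)
        finally show ?thesis .
      qed
      thus "\<exists>d>0. \<forall>y\<in>surf F. norm (y - q) < d \<longrightarrow> norm (psiS y - psiS q - l (y - q)) \<le> e * norm (y - q)"
        using d(1) by blast
    qed
    obtain X w where X: "j (F x0) = DF x0 X" "\<And>h. g x0 \<bullet> h = w * (fst X * snd h - snd X * fst h)"
      using g_coordinates[OF x0(1)] by blast
    show "l (j q) = 0" unfolding x0(2) X(1) lDF X(2) by simp
  qed
qed

lemma level_set_cone:
  assumes q: "q \<in> surf F" and jq: "j q \<noteq> 0"
  obtains C d where "C > 0" "d > 0"
    "\<And>p. p \<in> surf F \<Longrightarrow> norm (p - q) < d \<Longrightarrow> psiS p = psiS q \<Longrightarrow> norm (p - q) \<le> C * \<bar>j q \<bullet> (p - q)\<bar>"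
proof -
  obtain x0 where x0: "x0 \<in> strip" "q = F x0" using q by (auto simp: surf_def)
  obtain X w where X: "j (F x0) = DF x0 X" "w > 0" "\<And>h. g x0 \<bullet> h = w * (fst X * snd h - snd X * fst h)"
    using g_coordinates[OF x0(1)] by metis
  define \<Phi> where "\<Phi> x = (psi x, j q \<bullet> F x)" for x
  have der: "(\<Phi> has_derivative (\<lambda>h. (g x0 \<bullet> h, j q \<bullet> DF x0 h))) (at x0 within strip)"
    unfolding \<Phi>_def by (intro has_derivative_Pair psi_deriv x0 has_derivative_inner_right
        has_derivative_at_withinI[OF F_deriv])
  have inj: "h = 0" if "(g x0 \<bullet> h, j q \<bullet> DF x0 h) = 0" for h
  proof -
    have X0: "X \<noteq> 0"
    proof
      assume "X = 0"
      hence "j q = 0" unfolding x0(2) X(1) by (simp only: linear_0[OF linear_DF])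
      thus False using jq by simp
    qed
    have cross: "fst X * snd h = snd X * fst h" using that X by (simp add: zero_prod_def)
    obtain c where c: "h = c *\<^sub>R X"
    proof (cases "fst X = 0")
      case True
      hence "snd X \<noteq> 0" using X0 by (simp add: prod_eq_iff)
      thus thesis using that[of "snd h / snd X"] cross True by (simp add: prod_eq_iff)
    next
      case False
      thus thesis using that[of "fst h / fst X"] cross by (simp add: prod_eq_iff field_simps)
    qed
    have "j q \<bullet> DF x0 h = c * (j q \<bullet> j q)"
      using c X(1) x0 by (simp add: linear_cmul[OF linear_DF])
    hence "c = 0" using that jq by (simp add: zero_prod_def)
    thus ?thesis using c by simp
  qed
  obtain \<kappa> d1 where \<kappa>: "\<kappa> > 0" "d1 > 0"
    "\<And>y. y \<in> strip \<Longrightarrow> norm (y - x0) < d1 \<Longrightarrow> \<kappa> * norm (y - x0) \<le> norm (\<Phi> y - \<Phi> x0)"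
    using injective_derivative_expanding[OF der inj] by metis
  obtain B where B: "B > 0" "\<And>h. norm (DF x0 h) \<le> B * norm h" using linear_bounded_pos[OF linear_DF] by blast
  obtain d2 where d2: "d2 > 0" "\<And>y. norm (y - x0) < d2 \<Longrightarrow>
            norm (F y - F x0 - DF x0 (y - x0)) \<le> 1 * norm (y - x0)"
    using has_derivative_linear_approx[OF F_deriv[of x0] zero_less_one] by auto
  obtain d where d: "d > 0" "\<And>p. p \<in> surf F \<Longrightarrow> norm (p - F x0) < d \<Longrightarrow> \<exists>x\<in>strip. F x = p \<and> norm (x - x0) < min d1 d2"
    using local_lift[OF x0(1), of "min d1 d2"] \<kappa>(2) d2(1) by auto
  show thesis
  proof (rule that[of "(B + 1) / \<kappa>" d])
    fix p assume p: "p \<in> surf F" "norm (p - q) < d" "psiS p = psiS q"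
    obtain x where x: "x \<in> strip" "F x = p" "norm (x - x0) < min d1 d2" using d(2) p x0 by blast
    have "norm (F x - F x0) \<le> norm (F x - F x0 - DF x0 (x - x0)) + norm (DF x0 (x - x0))"
      using norm_triangle_ineq[of "F x - F x0 - DF x0 (x - x0)" "DF x0 (x - x0)"] by simp
    also have "\<dots> \<le> 1 * norm (x - x0) + B * norm (x - x0)"
      using d2(2)[of x] B(2) x(3) by (intro add_mono) auto
    finally have 1: "norm (p - q) \<le> (B + 1) * norm (x - x0)" using x x0 by (simp add: algebra_simps)
    have "psi x = psi x0" using p(3) psiS_F[OF x(1)] psiS_F[OF x0(1)] unfolding x0(2) x(2) by simp
    hence "\<Phi> x - \<Phi> x0 = (0, j q \<bullet> (p - q))" by (simp add: \<Phi>_def x x0 inner_diff_right)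
    hence "\<kappa> * norm (x - x0) \<le> \<bar>j q \<bullet> (p - q)\<bar>" using \<kappa>(3)[OF x(1)] x(3) by (simp add: norm_Pair)
    hence "(B + 1) * (\<kappa> * norm (x - x0)) \<le> (B + 1) * \<bar>j q \<bullet> (p - q)\<bar>"
      using B by (intro mult_left_mono) auto
    moreover have "\<kappa> * norm (p - q) \<le> \<kappa> * ((B + 1) * norm (x - x0))"
      using 1 \<kappa>(1) by (intro mult_left_mono) auto
    ultimately have "\<kappa> * norm (p - q) \<le> (B + 1) * \<bar>j q \<bullet> (p - q)\<bar>" by (simp add: mult_ac)
    thus "norm (p - q) \<le> (B + 1) / \<kappa> * \<bar>j q \<bullet> (p - q)\<bar>" using \<kappa>(1) by (simp add: field_simps)
  qed (use B \<kappa> d in auto)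
qed

lemma orbit_psiS:
  assumes "orbit (surf F) j p \<gamma>"
  shows "psiS (\<gamma> t) = psiS p"
proof -
  have \<gamma>: "\<gamma> 0 = p" "\<And>t. \<gamma> t \<in> surf F" "\<And>t. (\<gamma> has_derivative (\<lambda>h. h *\<^sub>R j (\<gamma> t))) (at t)"
    using assms by (auto simp: orbit_def has_vector_derivative_def)
  have "((psiS \<circ> \<gamma>) has_derivative (\<lambda>h. 0)) (at t)" for t
  proof -
    obtain l where l: "(psiS has_derivative l) (at (\<gamma> t) within surf F)" "l (j (\<gamma> t)) = 0"
      using psiS_deriv[OF \<gamma>(2)] .
    have "(psiS has_derivative l) (at (\<gamma> t) within range \<gamma>)"
      by (rule has_derivative_subset[OF l(1)]) (use \<gamma>(2) in auto)
    from diff_chain_within[OF \<gamma>(3) this]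
    have "((psiS \<circ> \<gamma>) has_derivative (l \<circ> (\<lambda>h. h *\<^sub>R j (\<gamma> t)))) (at t)" .
    moreover have "l \<circ> (\<lambda>h. h *\<^sub>R j (\<gamma> t)) = (\<lambda>h. 0)"
      using linear_cmul[OF has_derivative_linear[OF l(1)]] l(2) by (simp add: fun_eq_iff)
    ultimately show ?thesis by simp
  qed
  hence "(psiS \<circ> \<gamma>) t = (psiS \<circ> \<gamma>) 0"
    using has_derivative_zero_unique[of UNIV "psiS \<circ> \<gamma>"] by (metis UNIV_I convex_UNIV)
  thus ?thesis using \<gamma>(1) by simp
qed

end

section \<open>Orbits\<close>

lemma Gronwall_zero:
  fixes u :: "real \<Rightarrow> real"
  assumes u: "\<And>t. (u has_real_derivative u' t) (at t)" and nonneg: "\<And>t. u t \<ge> 0"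
    and bound: "\<And>t. \<bar>u' t\<bar> \<le> K * u t" and 0: "u 0 = 0"
  shows "u t = 0"
proof (cases "t \<ge> 0")
  case True
  have "u t * exp (- K * t) \<le> u 0 * exp (- K * 0)"
  proof (rule DERIV_nonpos_imp_nonincreasing[OF True, where f="\<lambda>s. u s * exp (- K * s)"])
    fix s
    have "((\<lambda>s. u s * exp (- K * s)) has_real_derivative (u' s - K * u s) * exp (- K * s)) (at s)"
      by (auto intro!: derivative_eq_intros u simp: algebra_simps)
    moreover have "(u' s - K * u s) * exp (- K * s) \<le> 0"
      using bound[of s] by (intro mult_nonpos_nonneg) auto
    ultimately show "\<exists>y. ((\<lambda>s. u s * exp (- K * s)) has_real_derivative y) (at s) \<and> y \<le> 0" by blast
  qed
  hence "u t * exp (- K * t) \<le> 0" using 0 by simp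
  thus ?thesis using nonneg[of t] by (simp add: mult_le_0_iff)
next
  case False
  have "u t * exp (K * t) \<le> u 0 * exp (K * 0)"
  proof (rule DERIV_nonneg_imp_nondecreasing[where f="\<lambda>s. u s * exp (K * s)"])
    fix s
    have "((\<lambda>s. u s * exp (K * s)) has_real_derivative (u' s + K * u s) * exp (K * s)) (at s)"
      by (auto intro!: derivative_eq_intros u simp: algebra_simps)
    moreover have "(u' s + K * u s) * exp (K * s) \<ge> 0"
      using bound[of s] by (intro mult_nonneg_nonneg) auto
    ultimately show "\<exists>y. ((\<lambda>s. u s * exp (K * s)) has_real_derivative y) (at s) \<and> 0 \<le> y" by blast
  qed (use False in auto)
  hence "u t * exp (K * t) \<le> 0" using 0 by simp
  thus ?thesis using nonneg[of t] by (simp add: mult_le_0_iff)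
qed

context annulus_field
begin

lemma field_Lipschitz:
  obtains L where "L > 0" "\<And>p q. p \<in> surf F \<Longrightarrow> q \<in> surf F \<Longrightarrow> norm (j p - j q) \<le> L * norm (p - q)"
proof -
  obtain r where r: "surf F \<subseteq> cball 0 r"
    using compact_imp_bounded[OF compact_surf] bounded_subset_ballD[of "surf F" 0] ball_subset_cball by blast
  have "bounded ((\<lambda>p. Dj p b) ` cball 0 r)" for b
    by (intro compact_imp_bounded compact_continuous_image cont_Dj compact_cball)
  hence "\<exists>B. \<forall>p\<in>cball 0 r. norm (Dj p b) \<le> B" for b by (auto simp: bounded_iff)
  then obtain B where B: "\<And>b p. p \<in> cball 0 r \<Longrightarrow> norm (Dj p b) \<le> B b" by metis
  define c where "c = Max (B ` (Basis :: R3 set))"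
  define L where "L = \<bar>c * DIM(R3)\<bar> + 1"
  have "norm (Dj p h) \<le> L * norm h" if p: "p \<in> cball 0 r" for p h
  proof -
    have "norm (Dj p b) \<le> c" if "b \<in> Basis" for b
      using B[OF p, of b] that by (auto simp: c_def intro: order_trans[OF _ Max_ge])
    hence "norm (Dj p h) \<le> c * DIM(R3) * norm h" by (rule linear_norm_bound_Basis[OF linear_Dj])
    also have "\<dots> \<le> L * norm h" unfolding L_def by (intro mult_right_mono) auto
    finally show ?thesis .
  qed
  hence on: "onorm (Dj p) \<le> L" if "p \<in> cball 0 r" for p using that by (intro onorm_le) auto
  show thesis
  proof (rule that[of L])
    show "L > 0" by (simp add: L_def)
    fix p q assume "p \<in> surf F" "q \<in> surf F"
    thus "norm (j p - j q) \<le> L * norm (p - q)"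
      using r by (intro differentiable_bound[where S="cball 0 r" and f'=Dj])
        (auto intro: on has_derivative_at_withinI[OF j_deriv])
  qed
qed

lemma orbit_shift: "orbit (surf F) j p \<gamma> \<Longrightarrow> orbit (surf F) j (\<gamma> c) (\<lambda>t. \<gamma> (t + c))"
proof -
  assume o: "orbit (surf F) j p \<gamma>"
  have "((\<gamma> \<circ> (\<lambda>t. t + c)) has_vector_derivative 1 *\<^sub>R j (\<gamma> (t + c))) (at t)" for t
    by (rule vector_diff_chain_at) (use o in \<open>auto simp: orbit_def intro!: derivative_eq_intros\<close>)
  thus ?thesis using o by (simp add: orbit_def o_def)
qed

lemma orbit_unique:
  assumes o1: "orbit (surf F) j p \<alpha>" and o2: "orbit (surf F) j p \<beta>"
  shows "\<alpha> t = \<beta> t"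
proof -
  obtain L where L: "L > 0" "\<And>p q. p \<in> surf F \<Longrightarrow> q \<in> surf F \<Longrightarrow> norm (j p - j q) \<le> L * norm (p - q)"
    using field_Lipschitz by blast
  have S: "\<alpha> s \<in> surf F" "\<beta> s \<in> surf F" for s using o1 o2 by (auto simp: orbit_def)
  define u where "u s = (\<alpha> s - \<beta> s) \<bullet> (\<alpha> s - \<beta> s)" for s
  define u' where "u' s = 2 * ((\<alpha> s - \<beta> s) \<bullet> (j (\<alpha> s) - j (\<beta> s)))" for s
  have "u t = 0"
  proof (rule Gronwall_zero[where u=u and u'=u' and K="2 * L"])
    fix s
    have "((\<lambda>s. \<alpha> s - \<beta> s) has_vector_derivative (j (\<alpha> s) - j (\<beta> s))) (at s)"
      using o1 o2 by (auto simp: orbit_def intro: has_vector_derivative_diff)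
    hence d: "((\<lambda>s. \<alpha> s - \<beta> s) has_derivative (\<lambda>h. h *\<^sub>R (j (\<alpha> s) - j (\<beta> s)))) (at s)"
      by (simp add: has_vector_derivative_def)
    show "(u has_real_derivative u' s) (at s)"
      unfolding u_def[abs_def] has_field_derivative_def
      by (rule has_derivative_eq_rhs[OF has_derivative_inner[OF d d]])
         (simp add: u'_def fun_eq_iff inner_commute)
    show "u s \<ge> 0" by (simp add: u_def)
    have "\<bar>u' s\<bar> \<le> 2 * (norm (\<alpha> s - \<beta> s) * norm (j (\<alpha> s) - j (\<beta> s)))"
      unfolding u'_def abs_mult by (simp add: Cauchy_Schwarz_ineq2)
    also have "\<dots> \<le> 2 * (norm (\<alpha> s - \<beta> s) * (L * norm (\<alpha> s - \<beta> s)))"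
      using L(2)[OF S] by (intro mult_left_mono) auto
    also have "\<dots> = 2 * L * u s" by (simp add: u_def dot_square_norm power2_eq_square)
    finally show "\<bar>u' s\<bar> \<le> 2 * L * u s" .
  qed (use o1 o2 in \<open>auto simp: u_def orbit_def\<close>)
  thus ?thesis by (simp add: u_def)
qed

lemma orbit_return_period:
  assumes o: "orbit (surf F) j p \<gamma>" and eq: "\<gamma> s = \<gamma> t" and "s < t"
  shows "is_period \<gamma> (t - s)"
  unfolding is_period_def
proof (intro conjI allI)
  fix r
  have "\<gamma> ((r - s) + t) = \<gamma> ((r - s) + s)"
    using orbit_unique[OF orbit_shift[OF o, of t] orbit_shift[OF o, of s, unfolded eq], of "r - s"] .
  thus "\<gamma> (r + (t - s)) = \<gamma> r" by (simp add: algebra_simps)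
qed (use assms in simp)

lemma orbit_zero_constant:
  assumes "orbit (surf F) j p \<gamma>" "j p = 0"
  shows "\<gamma> t = p"
proof (rule orbit_unique[OF assms(1)])
  show "orbit (surf F) j p (\<lambda>t. p)" using assms by (auto simp: orbit_def)
qed

text \<open>Near a regular point \<open>q\<close> of the stream function the orbit lies in the cone
  \<open>norm (p - q) \<le> C \<bar>j q \<bullet> (p - q)\<bar>\<close>, so it can only pass through the hyperplane
  \<open>j q \<bullet> (p - q) = 0\<close> at the apex \<open>q\<close>.\<close>
lemma orbit_hits_nearby_regular_point:
  assumes q: "q \<in> surf F" and jq: "j q \<noteq> 0"
  obtains d where "d > 0"
    "\<And>p \<gamma> t. orbit (surf F) j p \<gamma> \<Longrightarrow> psiS p = psiS q \<Longrightarrow> norm (\<gamma> t - q) < d \<Longrightarrow>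
       \<exists>\<tau>. \<bar>\<tau> - t\<bar> \<le> 1 \<and> \<gamma> \<tau> = q"
proof -
  obtain C d0 where C: "C > 0" "d0 > 0"
    and cone: "\<And>p. p \<in> surf F \<Longrightarrow> norm (p - q) < d0 \<Longrightarrow> psiS p = psiS q \<Longrightarrow> norm (p - q) \<le> C * \<bar>j q \<bullet> (p - q)\<bar>"
    using level_set_cone[OF q jq] by metis
  define \<delta> where "\<delta> = (j q \<bullet> j q) / 2"
  have \<delta>: "\<delta> > 0" using jq by (simp add: \<delta>_def)
  have "continuous (at q) (\<lambda>p. j q \<bullet> j p)"
    using j_deriv has_derivative_continuous by (intro continuous_intros) blast
  then obtain d1 where d1: "d1 > 0" "\<And>p. dist p q < d1 \<Longrightarrow> dist (j q \<bullet> j p) (j q \<bullet> j q) < \<delta>"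
    using \<delta> unfolding continuous_at_eps_delta by (auto simp: dist_norm)
  have speed: "j q \<bullet> j p \<ge> \<delta>" if "norm (p - q) < d1" for p
    using d1(2)[of p] that unfolding dist_norm real_norm_def \<delta>_def by argo
  have "bounded (j ` surf F)" by (intro compact_imp_bounded compact_continuous_image cont_j compact_surf)
  then obtain V where V: "V > 0" "\<And>p. p \<in> surf F \<Longrightarrow> norm (j p) \<le> V"
    by (auto simp: bounded_pos)
  define N where "N = norm (j q)"
  have N: "N > 0" using jq by (simp add: N_def)
  define d where "d = min (min d0 d1 / (1 + V * N / \<delta>)) (\<delta> / N)"
  have pos: "1 + V * N / \<delta> > 0" using V N \<delta> by (simp add: add_pos_nonneg)
  show thesis
  proof (rule that[of d])
    show "d > 0" using C d1 pos \<delta> N by (simp add: d_def)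
    fix p \<gamma> t assume o: "orbit (surf F) j p \<gamma>" and lev: "psiS p = psiS q" and near: "norm (\<gamma> t - q) < d"
    have S: "\<gamma> s \<in> surf F" for s using o by (simp add: orbit_def)
    have der: "(\<gamma> has_vector_derivative j (\<gamma> s)) (at s)" for s using o by (simp add: orbit_def)
    define a where "a s = j q \<bullet> (\<gamma> s - q)" for s
    have a_der: "(a has_real_derivative j q \<bullet> j (\<gamma> s)) (at s)" for s
    proof -
      have "((\<lambda>s. \<gamma> s - q) has_derivative (\<lambda>h. h *\<^sub>R j (\<gamma> s))) (at s)"
        using has_derivative_diff[OF der[of s, unfolded has_vector_derivative_def] has_derivative_const[of q]] by simp
      from has_derivative_inner_right[OF this, of "j q"]
      show ?thesis unfolding a_def[abs_def] has_field_derivative_def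
        by (rule has_derivative_eq_rhs) (simp add: fun_eq_iff)
    qed
    define \<sigma> where "\<sigma> = \<bar>a t\<bar> / \<delta>"
    have a_le: "\<bar>a t\<bar> \<le> N * norm (\<gamma> t - q)" unfolding a_def N_def by (rule Cauchy_Schwarz_ineq2)
    have \<sigma>: "0 \<le> \<sigma>" "\<sigma> \<le> 1" "\<sigma> \<le> (N / \<delta>) * norm (\<gamma> t - q)"
    proof -
      show "0 \<le> \<sigma>" using \<delta> by (simp add: \<sigma>_def)
      show s3: "\<sigma> \<le> (N / \<delta>) * norm (\<gamma> t - q)" using a_le \<delta> by (simp add: \<sigma>_def field_simps)
      have "norm (\<gamma> t - q) \<le> \<delta> / N" using near by (simp add: d_def)
      hence "(N / \<delta>) * norm (\<gamma> t - q) \<le> 1" using N \<delta> by (simp add: field_simps)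
      thus "\<sigma> \<le> 1" using s3 by simp
    qed
    have close: "norm (\<gamma> s - q) < min d0 d1" if s: "\<bar>s - t\<bar> \<le> \<sigma>" for s
    proof -
      have "norm (\<gamma> s - \<gamma> t) \<le> V * norm (s - t)"
      proof (rule differentiable_bound[where S=UNIV and f'="\<lambda>s h. h *\<^sub>R j (\<gamma> s)"])
        show "onorm (\<lambda>h. h *\<^sub>R j (\<gamma> s)) \<le> V" for s
          using V(2)[OF S[of s]] by (intro onorm_le) (metis mult.commute mult_left_mono norm_ge_zero norm_scaleR real_norm_def)
      qed (use der in \<open>auto simp: has_vector_derivative_def\<close>)
      also have "\<dots> \<le> V * ((N / \<delta>) * norm (\<gamma> t - q))" using s \<sigma>(3) V(1) by (intro mult_left_mono) auto
      finally have "norm (\<gamma> s - q) \<le> V * ((N / \<delta>) * norm (\<gamma> t - q)) + norm (\<gamma> t - q)"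
        using norm_triangle_ineq[of "\<gamma> s - \<gamma> t" "\<gamma> t - q"] by simp
      also have "\<dots> = (1 + V * N / \<delta>) * norm (\<gamma> t - q)" by (simp add: algebra_simps)
      also have "\<dots> < (1 + V * N / \<delta>) * (min d0 d1 / (1 + V * N / \<delta>))"
        using near pos by (intro mult_strict_left_mono) (auto simp: d_def)
      also have "\<dots> = min d0 d1" using pos by simp
      finally show ?thesis .
    qed
    have zero: "\<gamma> \<tau> = q" if "a \<tau> = 0" "\<bar>\<tau> - t\<bar> \<le> \<sigma>" for \<tau>
      using cone[OF S, of \<tau>] close[OF that(2)] orbit_psiS[OF o, of \<tau>] lev that(1) by (simp add: a_def)
    have grow: "\<delta> * (s2 - s1) \<le> a s2 - a s1" if "t - \<sigma> \<le> s1" "s1 \<le> s2" "s2 \<le> t + \<sigma>" for s1 s2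
    proof -
      have "a s1 - \<delta> * s1 \<le> a s2 - \<delta> * s2"
      proof (rule DERIV_nonneg_imp_nondecreasing[OF that(2)])
        fix s assume s: "s1 \<le> s" "s \<le> s2"
        have "((\<lambda>s. a s - \<delta> * s) has_real_derivative (j q \<bullet> j (\<gamma> s) - \<delta>)) (at s)"
          by (auto intro!: derivative_eq_intros a_der)
        moreover have "norm (\<gamma> s - q) < d1" using close[of s] s that by (simp add: abs_le_iff)
        ultimately show "\<exists>y. ((\<lambda>s. a s - \<delta> * s) has_real_derivative y) (at s) \<and> 0 \<le> y"
          using speed[of "\<gamma> s"] by (intro exI[of _ "j q \<bullet> j (\<gamma> s) - \<delta>"]) auto
      qed
      thus ?thesis by (simp add: algebra_simps)
    qed
    have cont: "continuous_on A a" for A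
      using a_der DERIV_continuous by (blast intro: continuous_at_imp_continuous_on)
    have "\<delta> * \<sigma> = \<bar>a t\<bar>" using \<delta> by (simp add: \<sigma>_def)
    show "\<exists>\<tau>. \<bar>\<tau> - t\<bar> \<le> 1 \<and> \<gamma> \<tau> = q"
    proof (cases "a t \<le> 0")
      case True
      have "0 \<le> a (t + \<sigma>)" using grow[of t "t + \<sigma>"] \<sigma> True \<open>\<delta> * \<sigma> = \<bar>a t\<bar>\<close> by simp
      then obtain \<tau> where "t \<le> \<tau>" "\<tau> \<le> t + \<sigma>" "a \<tau> = 0"
        using IVT'[of a t 0 "t + \<sigma>"] True \<sigma> cont by auto
      thus ?thesis using zero[of \<tau>] \<sigma> by (intro exI[of _ \<tau>]) auto
    next
      case False
      have "a (t - \<sigma>) \<le> 0" using grow[of "t - \<sigma>" t] \<sigma> False \<open>\<delta> * \<sigma> = \<bar>a t\<bar>\<close> by simp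
      then obtain \<tau> where "t - \<sigma> \<le> \<tau>" "\<tau> \<le> t" "a \<tau> = 0"
        using IVT'[of a "t - \<sigma>" 0 t] False \<sigma> cont by auto
      thus ?thesis using zero[of \<tau>] \<sigma> by (intro exI[of _ \<tau>]) auto
    qed
  qed
qed

lemma omega_limit_psiS:
  assumes o: "orbit (surf F) j p \<gamma>" and q: "q \<in> omega_limit \<gamma>"
  shows "q \<in> surf F" "psiS q = psiS p"
proof -
  obtain tk where tk: "(\<lambda>k. \<gamma> (tk k)) \<longlonglongrightarrow> q" using q by (auto simp: omega_limit_def)
  have S: "\<gamma> (tk k) \<in> surf F" for k using o by (simp add: orbit_def)
  show qS: "q \<in> surf F"
    using closed_sequentially[OF compact_imp_closed[OF compact_surf] S tk] by simp
  have "(\<lambda>k. psiS (\<gamma> (tk k))) \<longlonglongrightarrow> psiS q"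
    by (rule continuous_on_tendsto_compose[OF cont_psiS tk qS]) (use S in simp)
  thus "psiS q = psiS p" using orbit_psiS[OF o] by (simp add: LIMSEQ_const_iff)
qed

lemma omega_limit_nonempty:
  assumes o: "orbit (surf F) j p \<gamma>"
  shows "omega_limit \<gamma> \<noteq> {}"
proof -
  have "\<forall>k. \<gamma> (real k) \<in> surf F" using o by (simp add: orbit_def)
  then obtain q r where r: "strict_mono (r :: nat \<Rightarrow> nat)" "((\<lambda>k. \<gamma> (real k)) \<circ> r) \<longlonglongrightarrow> q"
    using compact_imp_seq_compact[OF compact_surf] unfolding seq_compact_def by metis
  have "filterlim (\<lambda>k. real (r k)) at_top sequentially"
    using filterlim_compose[OF filterlim_real_sequentially filterlim_subseq[OF r(1)]] .
  thus ?thesis using r(2) unfolding omega_limit_def by (auto simp: o_def)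
qed

lemma omega_limit_nonperiodic:
  assumes o: "orbit (surf F) j p \<gamma>" and np: "\<not> periodic_orbit \<gamma>" and q: "q \<in> omega_limit \<gamma>"
  shows "j q = 0"
proof (rule ccontr)
  assume jq: "j q \<noteq> 0"
  note qS = omega_limit_psiS[OF o q]
  obtain d where d: "d > 0" "\<And>p \<gamma> t. orbit (surf F) j p \<gamma> \<Longrightarrow> psiS p = psiS q \<Longrightarrow> norm (\<gamma> t - q) < d \<Longrightarrow>
       \<exists>\<tau>. \<bar>\<tau> - t\<bar> \<le> 1 \<and> \<gamma> \<tau> = q"
    using orbit_hits_nearby_regular_point[OF qS(1) jq] by metis
  obtain tk where tk: "filterlim tk at_top sequentially" "(\<lambda>k. \<gamma> (tk k)) \<longlonglongrightarrow> q"
    using q by (auto simp: omega_limit_def)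
  have near: "\<forall>\<^sub>F k in sequentially. norm (\<gamma> (tk k) - q) < d"
    using tk(2) d(1) by (simp add: tendsto_iff dist_norm)
  obtain k where k: "norm (\<gamma> (tk k) - q) < d"
    using eventually_happens[OF near] by auto
  have "\<forall>\<^sub>F m in sequentially. tk k + 3 \<le> tk m" using tk(1) by (simp add: filterlim_at_top)
  with near have "\<forall>\<^sub>F m in sequentially. norm (\<gamma> (tk m) - q) < d \<and> tk k + 3 \<le> tk m"
    by (rule eventually_conj)
  then obtain m where m: "norm (\<gamma> (tk m) - q) < d" "tk k + 3 \<le> tk m"
    using eventually_happens by fastforce
  obtain s t where "\<bar>s - tk k\<bar> \<le> 1" "\<gamma> s = q" "\<bar>t - tk m\<bar> \<le> 1" "\<gamma> t = q"
    using d(2)[OF o qS(2)[symmetric]] k m(1) by meson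
  hence "is_period \<gamma> (t - s)" using m(2) by (intro orbit_return_period[OF o]) auto
  thus False using np by (auto simp: periodic_orbit_def)
qed

lemma critical_values_negligible: "negligible (psi ` {x \<in> strip. g x = 0})"
proof (rule negligible_subset)
  let ?U = "UNIV \<times> {0<..<1} :: (real \<times> real) set"
  have sub: "?U \<subseteq> strip" by (auto simp: strip_def)
  have op: "open ?U" by (simp add: open_Times)
  have "negligible (psi ` {x \<in> ?U. g x = 0})"
  proof (rule Sard_plane[OF op, where Dg="\<lambda>x h. (dg1 x h, dg2 x h)"])
    fix x assume x: "x \<in> ?U"
    hence "(psi has_derivative (\<lambda>h. g x \<bullet> h)) (at x within ?U)"
      using psi_deriv[of x] sub by (auto intro: has_derivative_subset)
    thus "(psi has_derivative (\<lambda>h. g x \<bullet> h)) (at x)" using at_within_open[OF x op] by simp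
    show "(g has_derivative (\<lambda>h. (dg1 x h, dg2 x h))) (at x)" by (rule g_deriv) (use x sub in blast)
  next
    show "continuous_on ?U (\<lambda>x. (dg1 x h, dg2 x h))" for h
      by (intro continuous_on_Pair continuous_on_subset[OF cont_dg(1) sub] continuous_on_subset[OF cont_dg(2) sub])
  qed
  thus "negligible (psi ` {x \<in> ?U. g x = 0} \<union> {psi (0, 0), psi (0, 1)})" by (simp add: negligible_finite)
  have bdy: "psi (s, t) = psi (0, t)" if t: "t \<in> {0, 1}" for s t
  proof -
    have "((\<lambda>s. psi (s, t)) has_derivative (\<lambda>h. 0)) (at s)" for s
    proof -
      have S: "(s, t) \<in> strip" using t by (auto simp: strip_def)
      have "(psi has_derivative (\<lambda>h. g (s, t) \<bullet> h)) (at (s, t) within range (\<lambda>s. (s, t)))"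
        by (rule has_derivative_subset[OF psi_deriv[OF S]]) (use t in \<open>auto simp: strip_def\<close>)
      from diff_chain_within[OF has_derivative_Pair[OF has_derivative_ident has_derivative_const] this]
      show ?thesis using g1_boundary[OF t] by (simp add: o_def g_def)
    qed
    thus ?thesis using has_derivative_zero_unique[of UNIV "\<lambda>s. psi (s, t)"] by (metis UNIV_I convex_UNIV)
  qed
  show "psi ` {x \<in> strip. g x = 0} \<subseteq> psi ` {x \<in> ?U. g x = 0} \<union> {psi (0, 0), psi (0, 1)}"
  proof
    fix c assume "c \<in> psi ` {x \<in> strip. g x = 0}"
    then obtain s t where st: "c = psi (s, t)" "(s, t) \<in> strip" "g (s, t) = 0" by auto
    show "c \<in> psi ` {x \<in> ?U. g x = 0} \<union> {psi (0, 0), psi (0, 1)}"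
    proof (cases "t \<in> {0, 1}")
      case True
      thus ?thesis using bdy[OF True, of s] st(1) by auto
    next
      case False
      hence "(s, t) \<in> ?U" using st(2) by (auto simp: strip_def)
      thus ?thesis using st by blast
    qed
  qed
qed

lemma g_zero_iff:
  assumes x: "x \<in> strip"
  shows "g x = 0 \<longleftrightarrow> j (F x) = 0"
proof -
  obtain X w where X: "j (F x) = DF x X" "w > 0" "g x = (- w * snd X, w * fst X)"
    using g_coordinates[OF x] by metis
  have "g x = 0 \<longleftrightarrow> X = 0" using X by (auto simp: zero_prod_def prod_eq_iff)
  thus ?thesis using X(1) immersion[OF x, of X] linear_0[OF linear_DF, of x] by auto
qed

lemma almost_all_periodic:
  "\<exists>S. zero_area F S \<and> (\<forall>p \<in> surf F - S. \<forall>\<gamma>. orbit (surf F) j p \<gamma> \<longrightarrow> periodic_orbit \<gamma>)"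
proof -
  let ?D = "{0..<1} \<times> {0..1} :: (real \<times> real) set"
  define Z where "Z = psi ` {x \<in> strip. g x = 0}"
  define N where "N = {x \<in> strip. g x \<noteq> 0 \<and> psi x \<in> Z}"
  define S where "S = F ` N"
  have N: "negligible N" unfolding N_def
    by (rule negligible_regular_preimage[OF psi_deriv]) (auto simp: Z_def critical_values_negligible)
  have sub: "{x \<in> ?D. F x \<in> S} \<subseteq> N"
  proof
    fix z assume "z \<in> {x \<in> ?D. F x \<in> S}"
    then obtain s t where z: "z = (s, t)" and st: "(s, t) \<in> ?D" "F (s, t) \<in> S" by (cases z) auto
    hence x: "(s, t) \<in> strip" by (auto simp: strip_def)
    from st(2) obtain y where y: "y \<in> N" "F (s, t) = F y" by (auto simp: S_def)
    have yS: "y \<in> strip" using y by (simp add: N_def)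
    have "psi (s, t) = psi y" using psiS_F[OF x] psiS_F[OF yS] unfolding y(2) by simp
    moreover have "g (s, t) \<noteq> 0" using g_zero_iff[OF x] g_zero_iff[OF yS] y by (simp add: N_def)
    ultimately show "z \<in> N" using x y(1) z by (simp add: N_def)
  qed
  have neg: "negligible {x \<in> ?D. F x \<in> S}" using N sub by (rule negligible_subset)
  have "zero_area F S" unfolding zero_area_def
  proof (intro conjI)
    show "S \<subseteq> surf F" by (auto simp: S_def N_def surf_def)
    show "{x \<in> ?D. F x \<in> S} \<in> sets lebesgue" using neg by (rule negligible_imp_sets)
    show "area F S = 0" unfolding area_def
      using neg by (intro nn_integral_null_set) (simp add: negligible_iff_null_sets)
  qed
  moreover have "periodic_orbit \<gamma>" if p: "p \<in> surf F - S" and o: "orbit (surf F) j p \<gamma>" for p \<gamma>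
  proof (rule ccontr)
    assume np: "\<not> periodic_orbit \<gamma>"
    obtain x where x: "x \<in> strip" "p = F x" using p by (auto simp: surf_def)
    have "j p \<noteq> 0"
    proof
      assume "j p = 0"
      hence "is_period \<gamma> 1" using orbit_zero_constant[OF o] by (simp add: is_period_def)
      thus False using np by (auto simp: periodic_orbit_def)
    qed
    hence gx: "g x \<noteq> 0" using g_zero_iff[OF x(1)] x by simp
    obtain q where q: "q \<in> omega_limit \<gamma>" using omega_limit_nonempty[OF o] by blast
    note qS = omega_limit_psiS[OF o q]
    obtain y where y: "y \<in> strip" "q = F y" using qS(1) by (auto simp: surf_def)
    have "g y = 0" using omega_limit_nonperiodic[OF o np q] g_zero_iff[OF y(1)] y by simp
    moreover have "psi y = psi x" using qS(2) psiS_F[OF x(1)] psiS_F[OF y(1)] unfolding x(2) y(2) by simp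
    ultimately have "x \<in> N" using x(1) y(1) gx unfolding N_def Z_def by (auto intro!: image_eqI[of _ _ y])
    thus False using p x(2) by (auto simp: S_def)
  qed
  ultimately show ?thesis by blast
qed

end

section \<open>Contractible loops\<close>

lemma simple_subloop:
  fixes x :: "real \<Rightarrow> 'a::real_normed_vector"
  assumes cont: "continuous_on {0..1} x" and loop: "x 0 = x 1" and d: "d > 0"
    and inj: "\<And>u v. u \<in> {0..1} \<Longrightarrow> v \<in> {0..1} \<Longrightarrow> u < v \<Longrightarrow> v < u + d \<Longrightarrow> x u \<noteq> x v"
  obtains a b where "0 \<le> a" "a < b" "b \<le> 1" "x a = x b"
    "\<And>u v. a \<le> u \<Longrightarrow> u < v \<Longrightarrow> v \<le> b \<Longrightarrow> x u = x v \<Longrightarrow> u = a \<and> v = b"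
proof -
  define d' where "d' = min d 1"
  have d': "d' > 0" "d' \<le> 1" using d by (auto simp: d'_def)
  define I :: "(real \<times> real) set" where "I = {0..1} \<times> {0..1}"
  define K where "K = {w \<in> I. x (fst w) - x (snd w) \<in> {0}} \<inter> {w \<in> I. snd w - fst w \<in> {d'..}}"
  have I: "compact I" unfolding I_def by (intro compact_Times compact_Icc)
  have "continuous_on I (\<lambda>w. x (fst w) - x (snd w))"
    by (intro continuous_intros continuous_on_compose2[OF cont]) (auto simp: I_def)
  hence "closed {w \<in> I. x (fst w) - x (snd w) \<in> {0}}"
    using continuous_closed_preimage[OF _ compact_imp_closed[OF I], of "\<lambda>w. x (fst w) - x (snd w)" "{0}"]
    by (simp add: vimage_def Int_def conj_commute)
  moreover have "continuous_on I (\<lambda>w. snd w - fst w)" by (intro continuous_intros)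
  hence "closed {w \<in> I. snd w - fst w \<in> {d'..}}"
    using continuous_closed_preimage[OF _ compact_imp_closed[OF I], of "\<lambda>w. snd w - fst w" "{d'..}"]
    by (simp add: vimage_def Int_def conj_commute)
  ultimately have "closed K" unfolding K_def by blast
  moreover have "K \<subseteq> I" by (auto simp: K_def)
  ultimately have "compact K" using I by (metis compact_Int_closed inf.absorb_iff2)
  moreover have "K \<noteq> {}"
  proof -
    have "(0, 1) \<in> K" using loop d' by (simp add: K_def I_def)
    thus ?thesis by blast
  qed
  moreover have "continuous_on K (\<lambda>w. snd w - fst w)" by (intro continuous_intros)
  ultimately have "\<exists>w\<in>K. \<forall>w'\<in>K. snd w - fst w \<le> snd w' - fst w'" by (rule continuous_attains_inf)
  then obtain w where w: "w \<in> K" "\<And>w'. w' \<in> K \<Longrightarrow> snd w - fst w \<le> snd w' - fst w'" by blast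
  show thesis
  proof (rule that[of "fst w" "snd w"])
    show "0 \<le> fst w" "fst w < snd w" "snd w \<le> 1" "x (fst w) = x (snd w)"
      using w(1) d' by (auto simp: K_def I_def)
    fix u v assume uv: "fst w \<le> u" "u < v" "v \<le> snd w" "x u = x v"
    have UV: "u \<in> {0..1}" "v \<in> {0..1}" using uv w(1) by (auto simp: K_def I_def)
    have "d \<le> v - u" using inj[OF UV uv(2)] uv(4) by (cases "v < u + d") auto
    hence "(u, v) \<in> K" using uv UV by (auto simp: K_def I_def d'_def)
    from w(2)[OF this] show "u = fst w \<and> v = snd w" using uv by simp
  qed
qed

context annulus_field
begin

definition rep where "rep p = (SOME x. x \<in> strip \<and> F x = p)"

lemma rep_F:
  assumes "x \<in> strip"
  obtains n :: int where "rep (F x) = x + (of_int n, 0)"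
proof -
  have "rep (F x) \<in> strip \<and> F (rep (F x)) = F x"
    unfolding rep_def by (rule someI[of _ x]) (use assms in simp)
  thus thesis using F_eq_iff[OF assms, of "rep (F x)"] that by metis
qed

definition theta where "theta p = cis (2 * pi * fst (rep p))"
definition tau where "tau p = snd (rep p)"

lemma theta_F:
  assumes "x \<in> strip"
  shows "theta (F x) = cis (2 * pi * fst x)"
proof -
  obtain n :: int where n: "rep (F x) = x + (of_int n, 0)" using rep_F[OF assms] .
  have "cis (2 * pi * real_of_int n) = 1" by (rule cis_multiple_2pi) simp
  thus ?thesis by (simp add: theta_def n distrib_left flip: cis_mult)
qed

lemma tau_F: "x \<in> strip \<Longrightarrow> tau (F x) = snd x"
  unfolding tau_def using rep_F[of x] by (metis add.right_neutral snd_add snd_conv)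

lemma cont_theta: "continuous_on (surf F) theta"
  by (rule continuous_on_surf[where h="\<lambda>x. cis (2 * pi * fst x)"]) (auto intro!: continuous_intros simp: theta_F)

lemma cont_tau: "continuous_on (surf F) tau"
  by (rule continuous_on_surf[where h=snd]) (auto intro!: continuous_intros simp: tau_F)

lemma nullhomotopic_loop_lift:
  assumes hom: "homotopic_loops (surf F) c (linepath p p)"
    and cS: "\<And>u. c u \<in> surf F" and cont: "continuous_on UNIV c" and loop: "c 1 = c 0"
  obtains x where "continuous_on {0..1} x" "\<And>u. u \<in> {0..1} \<Longrightarrow> x u \<in> strip"
    "\<And>u. u \<in> {0..1} \<Longrightarrow> F (x u) = c u" "x 0 = x 1"
proof -
  let ?a = "\<lambda>z. Arg2pi z / (2 * pi)"
  have "homotopic_with_canon (\<lambda>h. True) (sphere 0 1) (surf F) (c \<circ> ?a) (linepath p p \<circ> ?a)"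
    by (rule homotopic_loops_imp_homotopic_circlemaps[OF hom])
  hence "homotopic_with_canon (\<lambda>h. True) (sphere 0 1) (-{0}) (theta \<circ> (c \<circ> ?a)) (theta \<circ> (linepath p p \<circ> ?a))"
    by (rule homotopic_with_compose_continuous_left[OF _ cont_theta]) (auto simp: theta_def)
  moreover have "theta \<circ> (linepath p p \<circ> ?a) = (\<lambda>z. theta p)"
    by (simp add: fun_eq_iff linepath_refl)
  ultimately obtain l where l: "continuous_on (sphere 0 1) l"
    "\<And>z. z \<in> sphere 0 1 \<Longrightarrow> (theta \<circ> (c \<circ> ?a)) z = exp (l z)"
    using inessential_eq_continuous_logarithm[of "sphere 0 1" "theta \<circ> (c \<circ> ?a)"] by metis
  have arg: "c (?a (cis (2 * pi * u))) = c u" if u: "u \<in> {0..1}" for u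
  proof (cases "u = 1")
    case True
    thus ?thesis using loop by (simp add: Arg2pi_of_real[of 1, simplified])
  next
    case False
    have "Arg2pi (cis (2 * pi * u)) = 2 * pi * u"
      by (rule Arg2pi_unique[of 1]) (use u False in \<open>auto simp: cis_conv_exp\<close>)
    thus ?thesis by simp
  qed
  define x where "x u = (Im (l (cis (2 * pi * u))) / (2 * pi), tau (c u))" for u
  have key: "x u \<in> strip \<and> F (x u) = c u" if u: "u \<in> {0..1}" for u
  proof -
    obtain s t where st: "c u = F (s, t)" "(s, t) \<in> strip" using cS[of u] by (auto simp: surf_def)
    let ?z = "l (cis (2 * pi * u))"
    have e: "exp ?z = cis (2 * pi * s)"
      using l(2)[of "cis (2 * pi * u)"] arg[OF u] theta_F[OF st(2)] st(1) by simp
    have "norm (exp ?z) = 1" unfolding e by simp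
    hence "Re ?z = 0" by simp
    hence "cis (Im ?z) = cis (2 * pi * s)" using e by (simp add: exp_eq_polar)
    hence "sin (Im ?z) = sin (2 * pi * s) \<and> cos (Im ?z) = cos (2 * pi * s)"
      by (simp add: complex_eq_iff)
    then obtain n :: int where "Im ?z = 2 * pi * s + 2 * pi * n" using sin_cos_eq_iff by metis
    hence "Im ?z / (2 * pi) = s + of_int n" by (simp add: field_simps)
    moreover have "tau (c u) = t" using tau_F[OF st(2)] st(1) by simp
    ultimately have "x u = (s + of_int n, t)" by (simp add: x_def)
    thus ?thesis using st F_shift_int by (auto simp: strip_def)
  qed
  show thesis
  proof (rule that[of x])
    show "continuous_on {0..1} x" unfolding x_def
    proof (intro continuous_on_Pair continuous_on_divide continuous_on_Im continuous_on_const)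
      show "continuous_on {0..1} (\<lambda>u. l (cis (2 * pi * u)))"
        by (rule continuous_on_compose2[OF l(1)]) (auto intro!: continuous_intros)
      show "continuous_on {0..1} (\<lambda>u. tau (c u))"
        by (rule continuous_on_compose2[OF cont_tau continuous_on_subset[OF cont]]) (use cS in auto)
    qed simp
    show "x 0 = x 1" using loop by (simp add: x_def)
  qed (use key in blast)+
qed

lemma orbit_locally_injective:
  assumes nz: "\<And>p. p \<in> surf F \<Longrightarrow> j p \<noteq> 0" and o: "orbit (surf F) j p \<gamma>"
  obtains d where "d > 0" "\<And>s t. s < t \<Longrightarrow> t < s + d \<Longrightarrow> \<gamma> s \<noteq> \<gamma> t"
proof -
  have S: "\<gamma> s \<in> surf F" for s using o by (simp add: orbit_def)
  have der: "(\<gamma> has_vector_derivative j (\<gamma> s)) (at s)" for s using o by (simp add: orbit_def)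
  obtain L where L: "L > 0" "\<And>p q. p \<in> surf F \<Longrightarrow> q \<in> surf F \<Longrightarrow> norm (j p - j q) \<le> L * norm (p - q)"
    using field_Lipschitz by blast
  have "bounded (j ` surf F)" by (intro compact_imp_bounded compact_continuous_image cont_j compact_surf)
  then obtain V where V: "V > 0" "\<And>p. p \<in> surf F \<Longrightarrow> norm (j p) \<le> V"
    by (auto simp: bounded_pos)
  obtain q where q: "q \<in> surf F" "\<And>p. p \<in> surf F \<Longrightarrow> norm (j q) \<le> norm (j p)"
    using continuous_attains_inf[OF compact_surf, of "\<lambda>p. norm (j p)"] S
    by (metis continuous_on_norm cont_j empty_iff)
  define m where "m = norm (j q)"
  have m: "m > 0" using nz[OF q(1)] by (simp add: m_def)
  show thesis
  proof (rule that[of "m / (L * V)"])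
    show "m / (L * V) > 0" using m L V by simp
    fix s t assume st: "s < t" "t < s + m / (L * V)"
    show "\<gamma> s \<noteq> \<gamma> t"
    proof
      assume eq: "\<gamma> s = \<gamma> t"
      define a where "a = j (\<gamma> s)"
      have "((\<lambda>r. a \<bullet> \<gamma> r) has_real_derivative a \<bullet> j (\<gamma> r)) (at r)" for r
        unfolding has_field_derivative_def
        by (rule has_derivative_eq_rhs[OF has_derivative_inner_right[OF der[of r, unfolded has_vector_derivative_def]]])
           (simp add: fun_eq_iff)
      then obtain r where r: "s < r" "r < t" "a \<bullet> \<gamma> t - a \<bullet> \<gamma> s = (t - s) * (a \<bullet> j (\<gamma> r))"
        using MVT2[OF st(1), of "\<lambda>r. a \<bullet> \<gamma> r" "\<lambda>r. a \<bullet> j (\<gamma> r)"] by blast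
      hence 0: "a \<bullet> j (\<gamma> r) = 0" using eq st(1) by simp
      have "norm (\<gamma> s - \<gamma> r) \<le> V * norm (s - r)"
      proof (rule differentiable_bound[where S=UNIV and f'="\<lambda>s h. h *\<^sub>R j (\<gamma> s)"])
        show "onorm (\<lambda>h. h *\<^sub>R j (\<gamma> s)) \<le> V" for s
          using V(2)[OF S[of s]] by (intro onorm_le) (metis mult.commute mult_left_mono norm_ge_zero norm_scaleR real_norm_def)
      qed (use der in \<open>auto simp: has_vector_derivative_def\<close>)
      also have "\<dots> < V * (m / (L * V))" using st r V(1) by (intro mult_strict_left_mono) auto
      also have "\<dots> = m / L" using V(1) by simp
      finally have "L * norm (\<gamma> s - \<gamma> r) < m" using L(1) by (simp add: field_simps)
      hence 1: "norm (a - j (\<gamma> r)) < m" using L(2)[OF S S, of s r] by (simp add: a_def)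
      have am: "norm a \<ge> m" using q(2)[OF S] by (simp add: a_def m_def)
      have "norm a * norm a = a \<bullet> (a - j (\<gamma> r))"
        using 0 by (simp add: inner_diff_right dot_square_norm power2_eq_square)
      also have "\<dots> \<le> norm a * norm (a - j (\<gamma> r))" by (rule norm_cauchy_schwarz)
      finally have "norm a \<le> norm (a - j (\<gamma> r))"
        by (rule mult_left_le_imp_le) (use am m in linarith)
      thus False using 1 am by simp
    qed
  qed
qed

text \<open>The stream function takes an extremum in the closure of the Jordan domain of a simple loop
  on which it is constant, and may be taken to do so in the open domain.\<close>
lemma critical_point_inside_loop:
  assumes c: "simple_path c" "pathfinish c = pathstart c"
    and strip: "\<And>z. z \<in> path_image c \<Longrightarrow> (Re z, Im z) \<in> strip"
    and const: "\<And>z. z \<in> path_image c \<Longrightarrow> psi (Re z, Im z) = k"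
  obtains x where "x \<in> strip" "g x = 0"
proof -
  let ?C = "path_image c"
  have J: "inside ?C \<noteq> {}" "open (inside ?C)" "bounded (inside ?C)" "frontier (inside ?C) = ?C"
    using Jordan_inside_outside[OF c] by auto
  have T: "convex {z. Im z \<ge> 0 \<and> Im z \<le> 1}" "?C \<subseteq> {z. Im z \<ge> 0 \<and> Im z \<le> 1}"
    using strip by (auto simp: strip_def convex_Int convex_halfspace_Im_ge convex_halfspace_Im_le Collect_conj_eq)
  have "- {z. Im z \<ge> 0 \<and> Im z \<le> 1} \<subseteq> outside ?C" using outside_subset_convex[OF T] .
  hence ins: "inside ?C \<subseteq> {z. Im z \<ge> 0 \<and> Im z \<le> 1}"
    using inside_Int_outside[of ?C] by blast
  define r :: "complex \<Rightarrow> real \<times> real" where "r z = (Re z, Im z)" for z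
  have r: "continuous_on A r" for A unfolding r_def by (intro continuous_intros)
  define U where "U = (\<lambda>x. Complex (fst x) (snd x)) -` inside ?C"
  have "open U" unfolding U_def
    by (rule open_vimage[OF J(2)]) (auto simp: Complex_eq intro!: continuous_intros)
  have rU: "r z \<in> U \<longleftrightarrow> z \<in> inside ?C" for z by (simp add: U_def r_def)
  have U: "U \<subseteq> strip" using ins by (auto simp: U_def strip_def)
  define K where "K = closure (inside ?C)"
  have K: "K = inside ?C \<union> ?C" unfolding K_def using J(4) by (simp add: closure_Un_frontier)
  have cK: "compact (r ` K)" unfolding K_def
    using J(3) by (intro compact_continuous_image r) (simp add: compact_closure)
  have rK: "r ` K \<subseteq> strip" using K rU U strip by (auto simp: r_def)
  have Kne: "r ` K \<noteq> {}" using J(1) K by blast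
  have cont: "continuous_on (r ` K) psi" using continuous_on_subset[OF cont_psi rK] .
  obtain x1 where x1: "x1 \<in> r ` K" "\<And>y. y \<in> r ` K \<Longrightarrow> psi y \<le> psi x1"
    using continuous_attains_sup[OF cK Kne cont] by blast
  obtain x2 where x2: "x2 \<in> r ` K" "\<And>y. y \<in> r ` K \<Longrightarrow> psi x2 \<le> psi y"
    using continuous_attains_inf[OF cK Kne cont] by blast
  have UK: "U \<subseteq> r ` K"
  proof
    fix y assume "y \<in> U"
    moreover have "y = r (Complex (fst y) (snd y))" by (simp add: r_def)
    ultimately show "y \<in> r ` K" using K by (auto simp: U_def)
  qed
  have off: "y \<in> U \<or> psi y = k" if "y \<in> r ` K" for y
  proof -
    obtain z where z: "z \<in> K" "y = r z" using \<open>y \<in> r ` K\<close> by blast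
    have "psi (r z) = k" if "z \<in> ?C" using const[OF that] by (simp add: r_def)
    thus ?thesis using z K rU[of z] by blast
  qed
  have "\<exists>x\<in>U. (\<forall>y\<in>U. psi y \<le> psi x) \<or> (\<forall>y\<in>U. psi x \<le> psi y)"
  proof (cases "x1 \<in> U \<or> x2 \<in> U")
    case True
    thus ?thesis
      using x1(2)[OF subsetD[OF UK]] x2(2)[OF subsetD[OF UK]] by meson
  next
    case False
    hence "psi x1 = k" "psi x2 = k" using off[OF x1(1)] off[OF x2(1)] by simp_all
    hence "psi y = k" if "y \<in> U" for y using x1(2)[of y] x2(2)[of y] subsetD[OF UK that] by simp
    hence "\<forall>x\<in>U. \<forall>y\<in>U. psi y \<le> psi x" by simp
    moreover have "U \<noteq> {}" using J(1) rU by blast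
    ultimately show ?thesis by blast
  qed
  then obtain x where x: "x \<in> U" "(\<forall>y\<in>U. psi y \<le> psi x) \<or> (\<forall>y\<in>U. psi x \<le> psi y)" by blast
  have "x \<in> interior strip" using interior_maximal[OF U \<open>open U\<close>] x(1) by blast
  hence "at x within strip = at x" by (rule at_within_interior)
  moreover have xs: "x \<in> strip" using U x(1) by (rule subsetD)
  ultimately have "(psi has_derivative (\<lambda>h. g x \<bullet> h)) (at x)" using psi_deriv[OF xs] by simp
  from fun_cong[OF differential_zero_maxmin[OF x(1) \<open>open U\<close> this x(2)], of "g x"]
  have "g x = 0" by simp
  with xs show thesis by (rule that)
qed

lemma periodic_orbit_noncontractible:
  assumes nz: "\<And>p. p \<in> surf F \<Longrightarrow> j p \<noteq> 0" and o: "orbit (surf F) j p \<gamma>" and T: "is_period \<gamma> T"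
  shows "\<not> homotopic_loops (surf F) (\<lambda>u. \<gamma> (T * u)) (linepath p p)"
proof
  assume hom: "homotopic_loops (surf F) (\<lambda>u. \<gamma> (T * u)) (linepath p p)"
  have S: "\<gamma> s \<in> surf F" for s using o by (simp add: orbit_def)
  have "isCont \<gamma> s" for s
    using o by (auto simp: orbit_def intro: has_vector_derivative_continuous)
  hence "continuous_on UNIV \<gamma>" by (simp add: continuous_at_imp_continuous_on)
  hence cont: "continuous_on UNIV (\<lambda>u. \<gamma> (T * u))"
    by (rule continuous_on_compose2) (auto intro!: continuous_intros)
  have T0: "T > 0" and "\<gamma> (T * 1) = \<gamma> (T * 0)" using T unfolding is_period_def by (auto dest: spec[of _ 0])
  then obtain x where x: "continuous_on {0..1} x" "\<And>u. u \<in> {0..1} \<Longrightarrow> x u \<in> strip"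
    "\<And>u. u \<in> {0..1} \<Longrightarrow> F (x u) = \<gamma> (T * u)" "x 0 = x 1"
    using nullhomotopic_loop_lift[OF hom S cont] by metis
  obtain d where d: "d > 0" "\<And>s t. s < t \<Longrightarrow> t < s + d \<Longrightarrow> \<gamma> s \<noteq> \<gamma> t"
    using orbit_locally_injective[OF nz o] by blast
  have dT: "d / T > 0" using d T0 by simp
  have sep: "x u \<noteq> x v" if uv: "u \<in> {0..1}" "v \<in> {0..1}" "u < v" "v < u + d / T" for u v
  proof -
    have "T * v < T * u + d" using uv(4) T0 by (simp add: field_simps)
    hence "\<gamma> (T * u) \<noteq> \<gamma> (T * v)" using uv(3) T0 by (intro d(2)) auto
    thus "x u \<noteq> x v" using x(3) uv by metis
  qed
  obtain a b where ab: "0 \<le> a" "a < b" "b \<le> 1" "x a = x b"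
    "\<And>u v. a \<le> u \<Longrightarrow> u < v \<Longrightarrow> v \<le> b \<Longrightarrow> x u = x v \<Longrightarrow> u = a \<and> v = b"
    using simple_subloop[OF x(1,4) dT sep] by blast
  define f where "f w = a + (b - a) * w" for w :: real
  have f: "f w \<in> {a..b}" if "w \<in> {0..1}" for w
  proof -
    have "0 \<le> (b - a) * w" "(b - a) * w \<le> (b - a) * 1"
      using that ab(2) by (auto intro!: mult_left_mono)
    thus ?thesis by (simp add: f_def)
  qed
  have f01: "f w \<in> {0..1}" if "w \<in> {0..1}" for w using f[OF that] ab by auto
  define c where "c w = Complex (fst (x (f w))) (snd (x (f w)))" for w
  have "continuous_on {0..1} (\<lambda>w. x (f w))"
    by (rule continuous_on_compose2[OF x(1)]) (use f01 in \<open>auto simp: f_def intro!: continuous_intros\<close>)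
  hence "path c" unfolding path_def c_def Complex_eq by (intro continuous_intros)
  moreover have inj: "u = 0 \<and> v = 1" if uv: "u \<in> {0..1}" "v \<in> {0..1}" "c u = c v" "u < v" for u v
  proof -
    have "x (f u) = x (f v)" using uv(3) by (simp add: c_def prod_eq_iff)
    moreover have "f u < f v" using uv(4) ab(2) by (simp add: f_def)
    ultimately have "f u = a \<and> f v = b" using ab(5)[of "f u" "f v"] f uv(1,2) by auto
    hence "(b - a) * u = 0" "(b - a) * (v - 1) = 0" by (simp_all add: f_def algebra_simps)
    thus ?thesis using ab(2) by simp
  qed
  have "loop_free c"
    unfolding loop_free_def
  proof (intro ballI impI)
    fix u v :: real assume uv: "u \<in> {0..1}" "v \<in> {0..1}" "c u = c v"
    consider "u = v" | "u < v" | "v < u" by linarith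
    thus "u = v \<or> u = 0 \<and> v = 1 \<or> u = 1 \<and> v = 0"
      using inj[OF uv] inj[OF uv(2,1) uv(3)[symmetric]] by cases auto
  qed
  ultimately have "simple_path c" by (simp add: simple_path_def)
  moreover have "pathfinish c = pathstart c" using ab(4) by (simp add: pathfinish_def pathstart_def c_def f_def)
  moreover have "(Re z, Im z) \<in> strip \<and> psi (Re z, Im z) = psiS p" if "z \<in> path_image c" for z
  proof -
    obtain w where w: "w \<in> {0..1}" "z = c w" using \<open>z \<in> path_image c\<close> by (auto simp: path_image_def)
    have "(Re z, Im z) = x (f w)" by (simp add: w c_def)
    moreover have "psi (x (f w)) = psiS p"
      using psiS_F[OF x(2)[OF f01[OF w(1)]]] x(3)[OF f01[OF w(1)]] orbit_psiS[OF o] by simp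
    ultimately show ?thesis using x(2)[OF f01[OF w(1)]] by simp
  qed
  ultimately obtain y where "y \<in> strip" "g y = 0"
    using critical_point_inside_loop[of c "psiS p"] by blast
  thus False using g_zero_iff nz by (auto simp: surf_def)
qed

lemma nonvanishing_orbits:
  assumes nz: "\<And>p. p \<in> surf F \<Longrightarrow> j p \<noteq> 0" and o: "orbit (surf F) j p \<gamma>"
  shows "periodic_orbit \<gamma>" "\<exists>t. \<gamma> t \<noteq> \<gamma> 0"
proof -
  obtain q where q: "q \<in> omega_limit \<gamma>" using omega_limit_nonempty[OF o] by blast
  show "periodic_orbit \<gamma>"
    using omega_limit_nonperiodic[OF o _ q] nz[OF omega_limit_psiS(1)[OF o q]] by blast
  obtain d where "d > 0" "\<And>s t. s < t \<Longrightarrow> t < s + d \<Longrightarrow> \<gamma> s \<noteq> \<gamma> t"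
    using orbit_locally_injective[OF nz o] by blast
  from this(2)[of 0 "d / 2"] this(1) show "\<exists>t. \<gamma> t \<noteq> \<gamma> 0" by (metis add.left_neutral field_sum_of_halves half_gt_zero less_add_same_cancel1)
qed

end

theorem theorem5p10:
  fixes F :: "real \<times> real \<Rightarrow> R3" and j :: "R3 \<Rightarrow> R3"
  assumes "annulus_param F"
    and "smooth j"
    and "tangent_field F j"
    and "\<forall>x\<in>strip. surf_div F j x = 0"
  shows "(\<exists>S. zero_area F S \<and>
            (\<forall>p \<in> surf F - S. \<forall>\<gamma>. orbit (surf F) j p \<gamma> \<longrightarrow> periodic_orbit \<gamma>))
       \<and> (\<forall>p \<in> surf F. \<forall>\<gamma>. orbit (surf F) j p \<gamma> \<and> \<not> periodic_orbit \<gamma> \<longrightarrow>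
            omega_limit \<gamma> \<subseteq> {q \<in> surf F. j q = 0})
       \<and> ((\<forall>p \<in> surf F. j p \<noteq> 0) \<longrightarrow>
            (\<forall>p \<in> surf F. \<forall>\<gamma>. orbit (surf F) j p \<gamma> \<longrightarrow>
               periodic_orbit \<gamma> \<and> (\<exists>t. \<gamma> t \<noteq> \<gamma> 0) \<and>
               (\<forall>T. is_period \<gamma> T \<longrightarrow>
                  \<not> homotopic_loops (surf F) (\<lambda>u. \<gamma> (T * u)) (linepath p p))))"
proof -
  interpret annulus_field F j by unfold_locales (rule assms)+
  show ?thesis
  proof (intro conjI allI ballI impI)
    show "\<exists>S. zero_area F S \<and> (\<forall>p \<in> surf F - S. \<forall>\<gamma>. orbit (surf F) j p \<gamma> \<longrightarrow> periodic_orbit \<gamma>)"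
      by (rule almost_all_periodic)
  next
    fix p \<gamma> assume "orbit (surf F) j p \<gamma> \<and> \<not> periodic_orbit \<gamma>"
    thus "omega_limit \<gamma> \<subseteq> {q \<in> surf F. j q = 0}"
      using omega_limit_nonperiodic omega_limit_psiS(1) by blast
  next
    fix p \<gamma> assume nz: "\<forall>p \<in> surf F. j p \<noteq> 0" and o: "orbit (surf F) j p \<gamma>"
    show "periodic_orbit \<gamma>" "\<exists>t. \<gamma> t \<noteq> \<gamma> 0"
      using nonvanishing_orbits[OF _ o] nz by blast+
    fix T assume "is_period \<gamma> T"
    thus "\<not> homotopic_loops (surf F) (\<lambda>u. \<gamma> (T * u)) (linepath p p)"
      using periodic_orbit_noncontractible[OF _ o] nz by blast
  qed
qed

end
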